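(* Let $G$ be a compact Hausdorff group, $X$ a complete operator space, and let $\nu\in M_{ac}(G,X)$ be a measure of bounded variation. If $X$ has the Radon-Nikodym Property with respect to $(G,\mathfrak{B}(G),m_G)$, then $\widehat{\nu}\in c_0\text{-}\bigoplus_{[\pi]\in\widehat{G}}M_{d_\pi}(X)$.
   Context: $\mathfrak{B}(G)$ is the Borel $\sigma$-algebra and $m_G$ the normalized Haar measure of $G$. $M_{ac}(G,X)$ is the space of $\sigma$-additive $X$-valued vector measures $\nu$ on $\mathfrak{B}(G)$ with $\lim_{m_G(A)\to0}\nu(A)=0$. $\nu$ has bounded variation if $|\nu|(G)=\sup\sum_{E\in\rho}\|\nu(E)\|<\infty$, the supremum over finite Borel partitions $\rho$ of $G$. $X$ has the Radon–Nikodym Property with respect to $(G,\mathfrak{B}(G),m_G)$ if for each $\nu\in M_{ac}(G,X)$ of bounded variation there is $f\in L^1(G,X)$ (Bochner integrable) with $d\nu=f\,dm_G$. $\widehat G$ (with the discrete topology) is the set of classes of irreducible unitary representations $\pi$ of $G$, $d_\pi=\dim\mathcal{H}_\pi$, $\pi(t)_{ij}=\langle\pi(t)e_j^\pi,e_i^\pi\rangle$ for a fixed ordered orthonormal basis. $\widehat\nu(\pi)\in M_{d_\pi}(X)$ is the matrix with entries $\frac1{d_\pi}\int_G\overline{\pi(t)_{ji}}\,d\nu(t)$. $M_{d_\pi}(X)$ carries the matrix norm of the operator space $X$. $c_0\text{-}\bigoplus_\alpha X_\alpha$ is the space of bounded families $(x_\alpha)$ with $\|x_\alpha\|\to0$ as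 $\alpha\to\infty$ (for each $\epsilon>0$, $\|x_\alpha\|<\epsilon$ for all but finitely many $\alpha$). *)

theory Defs
  imports
    "HOL-Analysis.Analysis"
    "HOL-Library.Disjoint_Sets"
    "Jordan_Normal_Form.Schur_Decomposition"
begin

text \<open>
  A compact Hausdorff group is a type of class \<^class>\<open>topological_group_add\<close> and
  \<^class>\<open>t2_space\<close> with compact universe. This class is the library's (not necessarily
  abelian) topological group; the group law is written \<open>+\<close> and the neutral element \<open>0\<close>.
\<close>

text \<open>
  The regularity conditions are the usual ones for a Radon measure; they make the normalized
  Haar measure unique also when \<open>G\<close> is not second countable.
\<close>

definition normalized_haar_measure :: "'g::{topological_group_add,t2_space} measure \<Rightarrow> bool" where
  "normalized_haar_measure m \<longleftrightarrow>
     sets m = sets borel \<and>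
     emeasure m UNIV = 1 \<and>
     (\<forall>x. \<forall>A\<in>sets borel. emeasure m ((\<lambda>y. x + y) ` A) = emeasure m A) \<and>
     (\<forall>A\<in>sets borel. emeasure m A = (INF U\<in>{U. open U \<and> A \<subseteq> U}. emeasure m U)) \<and>
     (\<forall>U. open U \<longrightarrow> emeasure m U = (SUP K\<in>{K. compact K \<and> K \<subseteq> U}. emeasure m K))"

text \<open>Only the values of a vector measure on \<open>sets M\<close> are relevant.\<close>

definition vector_measure :: "'g measure \<Rightarrow> ('g set \<Rightarrow> 'x::real_normed_vector) \<Rightarrow> bool" where
  "vector_measure M \<nu> \<longleftrightarrow>
     (\<forall>A :: nat \<Rightarrow> 'g set. range A \<subseteq> sets M \<longrightarrow> disjoint_family A \<longrightarrow>
        (\<lambda>n. \<nu> (A n)) sums \<nu> (\<Union>n. A n))"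

definition M_ac :: "'g measure \<Rightarrow> ('g set \<Rightarrow> 'x::real_normed_vector) set" where
  "M_ac M = {\<nu>. vector_measure M \<nu> \<and>
     (\<forall>\<epsilon>>0. \<exists>\<delta>>0. \<forall>A\<in>sets M. emeasure M A < ennreal \<delta> \<longrightarrow> norm (\<nu> A) < \<epsilon>)}"

definition variation :: "'g measure \<Rightarrow> ('g set \<Rightarrow> 'x::real_normed_vector) \<Rightarrow> ennreal" where
  "variation M \<nu> =
     (SUP \<rho>\<in>{\<rho>. finite \<rho> \<and> \<rho> \<subseteq> sets M \<and> partition_on (space M) \<rho>}.
        \<Sum>E\<in>\<rho>. ennreal (norm (\<nu> E)))"

definition bounded_variation :: "'g measure \<Rightarrow> ('g set \<Rightarrow> 'x::real_normed_vector) \<Rightarrow> bool" where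
  "bounded_variation M \<nu> \<longleftrightarrow> variation M \<nu> < \<infinity>"

text \<open>
  Bochner integral in an arbitrary Banach space: the clauses of the library's
  \<open>has_bochner_integral\<close>, which is only available for second countable (that is, separable)
  target spaces. Approximability by simple functions in the mean forces strong measurability.
\<close>

definition bochner_integral_is ::
    "'g measure \<Rightarrow> ('g \<Rightarrow> 'x::banach) \<Rightarrow> 'x \<Rightarrow> bool" where
  "bochner_integral_is M f x \<longleftrightarrow>
     f \<in> borel_measurable M \<and>
     (\<exists>s. (\<forall>n. Bochner_Integration.simple_bochner_integrable M (s n)) \<and>
          (\<lambda>n. \<integral>\<^sup>+t. ennreal (norm (f t - s n t)) \<partial>M) \<longlonglongrightarrow> 0 \<and>
          (\<lambda>n. Bochner_Integration.simple_bochner_integral M (s n)) \<longlonglongrightarrow> x)"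

definition bochner_integrable :: "'g measure \<Rightarrow> ('g \<Rightarrow> 'x::banach) \<Rightarrow> bool" where
  "bochner_integrable M f \<longleftrightarrow> (\<exists>x. bochner_integral_is M f x)"

definition radon_nikodym_property :: "'x::banach itself \<Rightarrow> 'g measure \<Rightarrow> bool" where
  "radon_nikodym_property X M \<longleftrightarrow>
     (\<forall>\<nu> :: 'g set \<Rightarrow> 'x. \<nu> \<in> M_ac M \<longrightarrow> bounded_variation M \<nu> \<longrightarrow>
        (\<exists>f. bochner_integrable M f \<and>
             (\<forall>A\<in>sets M. bochner_integral_is M (\<lambda>t. indicator A t *\<^sub>R f t) (\<nu> A))))"

definition cvec_norm :: "complex vec \<Rightarrow> real" where
  "cvec_norm v = sqrt (\<Sum>i<dim_vec v. (cmod (vec_index v i))\<^sup>2)"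

definition mat_op_norm :: "complex mat \<Rightarrow> real" where
  "mat_op_norm A =
     (SUP v\<in>{v \<in> carrier_vec (dim_col A). cvec_norm v \<le> 1}. cvec_norm (A *\<^sub>v v))"

text \<open>The product \<open>\<alpha> v \<beta>\<close> of a matrix \<open>v\<close> over \<open>X\<close> with scalar matrices \<open>\<alpha>\<close>, \<open>\<beta>\<close>.\<close>

definition scalar_mat_action ::
    "(complex \<Rightarrow> 'x \<Rightarrow> 'x::comm_monoid_add) \<Rightarrow> complex mat \<Rightarrow> 'x mat \<Rightarrow> complex mat \<Rightarrow> 'x mat" where
  "scalar_mat_action smul \<alpha> v \<beta> =
     mat (dim_row \<alpha>) (dim_col \<beta>)
       (\<lambda>(i,j). \<Sum>k<dim_row v. \<Sum>l<dim_col v. smul (\<alpha> $$ (i,k) * \<beta> $$ (l,j)) (v $$ (k,l)))"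

text \<open>
  A complete operator space in the sense of Effros and Ruan: a complex Banach space with norms on
  all \<open>M\<^sub>n(X)\<close> satisfying Ruan's axioms. The complex structure is given by \<open>smul\<close> and
  extends the real one of the type; completeness is part of \<^class>\<open>banach\<close>. The function \<open>mnorm\<close>
  is only relevant on square matrices, the size of the matrix selecting the norm.
\<close>

locale operator_space = vector_space smul
  for smul :: "complex \<Rightarrow> 'x::banach \<Rightarrow> 'x" +
  fixes mnorm :: "'x mat \<Rightarrow> real"
  assumes smul_of_real: "smul (complex_of_real r) x = r *\<^sub>R x"
    and norm_smul: "norm (smul c x) = cmod c * norm x"
    and mnorm_eq_0_iff: "v \<in> carrier_mat n n \<Longrightarrow> mnorm v = 0 \<longleftrightarrow> v = 0\<^sub>m n n"
    and mnorm_triangle: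
      "v \<in> carrier_mat n n \<Longrightarrow> w \<in> carrier_mat n n \<Longrightarrow> mnorm (v + w) \<le> mnorm v + mnorm w"
    and mnorm_smul: "v \<in> carrier_mat n n \<Longrightarrow> mnorm (map_mat (smul c) v) = cmod c * mnorm v"
    and mnorm_one: "mnorm (mat 1 1 (\<lambda>_. x)) = norm x"
    and mnorm_direct_sum:
      "v \<in> carrier_mat k k \<Longrightarrow> w \<in> carrier_mat n n \<Longrightarrow>
         mnorm (four_block_mat v (0\<^sub>m k n) (0\<^sub>m n k) w) = max (mnorm v) (mnorm w)"
    and mnorm_action:
      "\<alpha> \<in> carrier_mat n k \<Longrightarrow> v \<in> carrier_mat k k \<Longrightarrow> \<beta> \<in> carrier_mat k n \<Longrightarrow>
         mnorm (scalar_mat_action smul \<alpha> v \<beta>) \<le> mat_op_norm \<alpha> * mnorm v * mat_op_norm \<beta>"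

definition c0_direct_sum :: "'i set \<Rightarrow> ('i \<Rightarrow> 'a set) \<Rightarrow> ('a \<Rightarrow> real) \<Rightarrow> ('i \<Rightarrow> 'a) set" where
  "c0_direct_sum I X nrm =
     {x. (\<forall>i\<in>I. x i \<in> X i) \<and>
         bdd_above ((\<lambda>i. nrm (x i)) ` I) \<and>
         (\<forall>\<epsilon>>0. finite {i\<in>I. \<not> nrm (x i) < \<epsilon>})}"

text \<open>
  Since irreducible unitary representations of a compact group are finite-dimensional, and each
  representation space comes with a fixed ordered orthonormal basis, a representation is
  identified with its matrix \<open>\<pi>(t)\<^sub>i\<^sub>j\<close>, i.e. with a representation on \<open>\<complex>\<^sup>d\<close> with its
  standard basis. Matrix indices start at 0.
\<close>

definition unitary_mat :: "nat \<Rightarrow> complex mat \<Rightarrow> bool" where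
  "unitary_mat d U \<longleftrightarrow>
     U \<in> carrier_mat d d \<and> mat_adjoint U * U = 1\<^sub>m d \<and> U * mat_adjoint U = 1\<^sub>m d"

definition rep_dim :: "('g::zero \<Rightarrow> complex mat) \<Rightarrow> nat" where
  "rep_dim \<pi> = dim_row (\<pi> 0)"

definition unitary_rep :: "('g::topological_group_add \<Rightarrow> complex mat) \<Rightarrow> bool" where
  "unitary_rep \<pi> \<longleftrightarrow>
     (\<forall>t. unitary_mat (rep_dim \<pi>) (\<pi> t)) \<and>
     (\<forall>s t. \<pi> (s + t) = \<pi> s * \<pi> t) \<and>
     (\<forall>i<rep_dim \<pi>. \<forall>j<rep_dim \<pi>. continuous_on UNIV (\<lambda>t. \<pi> t $$ (i,j)))"

definition invariant_subspace ::
    "('g::topological_group_add \<Rightarrow> complex mat) \<Rightarrow> complex vec set \<Rightarrow> bool" where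
  "invariant_subspace \<pi> W \<longleftrightarrow>
     W \<subseteq> carrier_vec (rep_dim \<pi>) \<and> 0\<^sub>v (rep_dim \<pi>) \<in> W \<and>
     (\<forall>v\<in>W. \<forall>w\<in>W. v + w \<in> W) \<and> (\<forall>c. \<forall>v\<in>W. c \<cdot>\<^sub>v v \<in> W) \<and>
     (\<forall>t. \<forall>v\<in>W. \<pi> t *\<^sub>v v \<in> W)"

definition irreducible_unitary_rep :: "('g::topological_group_add \<Rightarrow> complex mat) \<Rightarrow> bool" where
  "irreducible_unitary_rep \<pi> \<longleftrightarrow>
     unitary_rep \<pi> \<and> rep_dim \<pi> > 0 \<and>
     (\<forall>W. invariant_subspace \<pi> W \<longrightarrow> W = {0\<^sub>v (rep_dim \<pi>)} \<or> W = carrier_vec (rep_dim \<pi>))"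

definition unitarily_equivalent ::
    "('g::topological_group_add \<Rightarrow> complex mat) \<Rightarrow> ('g \<Rightarrow> complex mat) \<Rightarrow> bool" where
  "unitarily_equivalent \<pi> \<rho> \<longleftrightarrow>
     rep_dim \<pi> = rep_dim \<rho> \<and>
     (\<exists>U. unitary_mat (rep_dim \<pi>) U \<and> (\<forall>t. U * \<pi> t = \<rho> t * U))"

definition unitary_dual :: "('g::topological_group_add \<Rightarrow> complex mat) set set" where
  "unitary_dual =
     {\<pi>. irreducible_unitary_rep \<pi>} //
     {(\<pi>, \<rho>). irreducible_unitary_rep \<pi> \<and> irreducible_unitary_rep \<rho> \<and> unitarily_equivalent \<pi> \<rho>}"

definition vm_simple_integral ::
    "(complex \<Rightarrow> 'x \<Rightarrow> 'x) \<Rightarrow> 'g measure \<Rightarrow> ('g set \<Rightarrow> 'x::comm_monoid_add) \<Rightarrow> ('g \<Rightarrow> complex) \<Rightarrow> 'x" where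
  "vm_simple_integral smul M \<nu> s =
     (\<Sum>c\<in>s ` space M. smul c (\<nu> (s -` {c} \<inter> space M)))"

text \<open>
  The elementary integral of a bounded measurable scalar function against a vector measure:
  the extension of the integral of simple functions by uniform limits.
\<close>

definition vm_has_integral ::
    "(complex \<Rightarrow> 'x \<Rightarrow> 'x) \<Rightarrow> 'g measure \<Rightarrow> ('g set \<Rightarrow> 'x::real_normed_vector) \<Rightarrow>
     ('g \<Rightarrow> complex) \<Rightarrow> 'x \<Rightarrow> bool" where
  "vm_has_integral smul M \<nu> f x \<longleftrightarrow>
     (\<exists>s. (\<forall>n. simple_function M (s n)) \<and> uniform_limit (space M) s f sequentially \<and>
          (\<lambda>n. vm_simple_integral smul M \<nu> (s n)) \<longlonglongrightarrow> x)"

definition vm_integral ::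
    "(complex \<Rightarrow> 'x \<Rightarrow> 'x) \<Rightarrow> 'g measure \<Rightarrow> ('g set \<Rightarrow> 'x::real_normed_vector) \<Rightarrow>
     ('g \<Rightarrow> complex) \<Rightarrow> 'x" where
  "vm_integral smul M \<nu> f = (THE x. vm_has_integral smul M \<nu> f x)"

definition fourier_coeff ::
    "(complex \<Rightarrow> 'x \<Rightarrow> 'x) \<Rightarrow> ('g set \<Rightarrow> 'x::real_normed_vector) \<Rightarrow>
     ('g::topological_group_add \<Rightarrow> complex mat) \<Rightarrow> 'x mat" where
  "fourier_coeff smul \<nu> \<pi> =
     mat (rep_dim \<pi>) (rep_dim \<pi>)
       (\<lambda>(i,j). smul (1 / of_nat (rep_dim \<pi>)) (vm_integral smul borel \<nu> (\<lambda>t. cnj (\<pi> t $$ (j,i)))))"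

end

theory Submission
  imports Defs "Jordan_Normal_Form.Spectral_Radius"
begin

text \<open>
  The Radon-Nikodym property turns \<open>\<nu>\<close> into \<open>f dm\<close> with \<open>f\<close> Bochner integrable, so \<open>f\<close> is a limit in the
  mean of simple functions \<open>s\<close>. Two facts then give the result, as in the classical
  Riemann-Lebesgue lemma.

  The first is a bound that is uniform in \<open>\<pi>\<close>: the norm of \<open>\<nu>\<close>'s coefficient at \<open>\<pi>\<close> is at most the total
  variation of \<open>\<nu>\<close> (\<open>mnorm_fourier_coeff_le\<close>). Cutting \<open>G\<close> into small cells \<open>E\<close> with sample
  points \<open>t\<close>, the coefficient is a limit of sums of elementary tensors of the contractions
  \<open>\<pi>(t)*/d\<close> with the vectors \<open>\<nu>(E)\<close>, and Ruan's axioms bound the norm of an elementary tensor by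
  the product of the two norms (\<open>mnorm_tensor_le\<close>). Boundedness of the family follows, and so does
  stability of convergence to zero under limits in variation (\<open>coeffs_vanish_limit\<close>). Since the
  variation of \<open>\<nu> - s dm\<close> is at most the integral of \<open>\<parallel>f - s\<parallel>\<close>, it remains to treat simple densities,
  hence, by additivity, densities that are an indicator function times a vector \<open>x\<close>.

  The second fact is scalar: for such a density the coefficient is the tensor of \<open>x\<close> with the
  scalar coefficient matrix of the indicator function. If the operator norm of that matrix is at least
  a fixed \<open>\<epsilon>\<close>, then pairing it with suitable unit vectors yields a matrix coefficient of \<open>\<pi>\<close>, bounded by 1,
  whose inner product with the indicator function is at least \<open>\<epsilon>/2\<close> (\<open>large_coeff_witness\<close>).
  Matrix coefficients of inequivalent representations are orthogonal (\<open>schur_orthogonality\<close>), so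
  Bessel's inequality leaves room for at most \<open>4/\<epsilon>\<^sup>2\<close> such classes.
\<close>

section \<open>Additive set functions of bounded variation\<close>

text \<open>
  Carrying a bound \<open>V\<close> as a parameter, rather than the variation itself, makes sums of measures and
  measures of small variation easy to handle.
\<close>

definition additive_variation_le :: "('g::topological_space set \<Rightarrow> 'x::real_normed_vector) \<Rightarrow> real \<Rightarrow> bool" where
  "additive_variation_le \<nu> V \<longleftrightarrow>
     (\<forall>A\<in>sets borel. \<forall>B\<in>sets borel. A \<inter> B = {} \<longrightarrow> \<nu> (A \<union> B) = \<nu> A + \<nu> B) \<and>
     (\<forall>\<rho>. finite \<rho> \<longrightarrow> \<rho> \<subseteq> sets borel \<longrightarrow> partition_on UNIV \<rho> \<longrightarrow> (\<Sum>E\<in>\<rho>. norm (\<nu> E)) \<le> V)"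

text \<open>
  A finite Borel partition, presented by the function that sends a point to the name of its cell.
  Common refinements are then pairs of labellings, and a simple function is a function of the label.
\<close>

definition finite_borel_labelling :: "('g::topological_space \<Rightarrow> 'l) \<Rightarrow> bool" where
  "finite_borel_labelling r \<longleftrightarrow> finite (range r) \<and> (\<forall>l. r -` {l} \<in> sets borel)"

lemma additive_variation_le_empty:
  assumes "additive_variation_le \<nu> V"
  shows "\<nu> {} = 0"
proof -
  have "\<nu> ({} \<union> {}) = \<nu> {} + \<nu> {}"
    using assms unfolding additive_variation_le_def by (metis sets.empty_sets inf_bot_left)
  then show ?thesis by simp
qed

lemma additive_variation_le_Union:
  assumes \<nu>: "additive_variation_le \<nu> V" and "finite I"
    and "\<And>i. i \<in> I \<Longrightarrow> A i \<in> sets borel" and "disjoint_family_on A I"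
  shows "\<nu> (\<Union>i\<in>I. A i) = (\<Sum>i\<in>I. \<nu> (A i))"
  using assms(2-)
proof (induction I)
  case empty
  then show ?case by (simp add: additive_variation_le_empty[OF \<nu>])
next
  case (insert i I)
  have "\<nu> (A i \<union> (\<Union>i\<in>I. A i)) = \<nu> (A i) + \<nu> (\<Union>i\<in>I. A i)"
  proof -
    have "A i \<inter> (\<Union>i\<in>I. A i) = {}"
      using insert.hyps insert.prems(2) by (fastforce simp: disjoint_family_on_def)
    moreover have "(\<Union>i\<in>I. A i) \<in> sets borel"
      using insert by (intro sets.finite_UN) auto
    ultimately show ?thesis
      using \<nu> insert.prems(1) unfolding additive_variation_le_def by blast
  qed
  moreover have "\<nu> (\<Union>i\<in>I. A i) = (\<Sum>i\<in>I. \<nu> (A i))"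
    using insert by (intro insert.IH) (auto simp: disjoint_family_on_def)
  ultimately show ?case using insert by simp
qed

lemma labelling_fibre_union:
  assumes "finite_borel_labelling r"
  shows "r -` L \<in> sets borel"
proof -
  have "r -` L = (\<Union>l\<in>L \<inter> range r. r -` {l})" by auto
  also have "\<dots> \<in> sets borel"
    using assms by (intro sets.finite_UN) (auto simp: finite_borel_labelling_def)
  finally show ?thesis .
qed

lemma labelling_comp:
  assumes "finite_borel_labelling r"
  shows "finite_borel_labelling (\<lambda>t. \<phi> (r t))"
  unfolding finite_borel_labelling_def
proof (intro conjI allI)
  have "range (\<lambda>t. \<phi> (r t)) = \<phi> ` range r" by auto
  then show "finite (range (\<lambda>t. \<phi> (r t)))" using assms by (simp add: finite_borel_labelling_def)
  fix l
  have "(\<lambda>t. \<phi> (r t)) -` {l} = r -` (\<phi> -` {l})" by auto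
  then show "(\<lambda>t. \<phi> (r t)) -` {l} \<in> sets borel" using labelling_fibre_union[OF assms] by simp
qed

lemma labelling_Pair:
  assumes "finite_borel_labelling r" "finite_borel_labelling s"
  shows "finite_borel_labelling (\<lambda>t. (r t, s t))"
  unfolding finite_borel_labelling_def
proof (intro conjI allI)
  have "range (\<lambda>t. (r t, s t)) \<subseteq> range r \<times> range s" by auto
  then show "finite (range (\<lambda>t. (r t, s t)))"
    using assms by (meson finite_SigmaI finite_borel_labelling_def finite_subset)
  fix l
  have "(\<lambda>t. (r t, s t)) -` {l} = r -` {fst l} \<inter> s -` {snd l}" by auto
  then show "(\<lambda>t. (r t, s t)) -` {l} \<in> sets borel"
    using assms by (auto simp: finite_borel_labelling_def intro!: sets.Int)
qed

lemma simple_function_borel_iff_labelling: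
  "simple_function borel s \<longleftrightarrow> finite_borel_labelling s"
proof -
  have "s -` {x} \<in> sets borel" if "x \<notin> range s" for x
  proof -
    have "s -` {x} = {}" using that by auto
    then show ?thesis by simp
  qed
  then have "(\<forall>x\<in>range s. s -` {x} \<in> sets borel) \<longleftrightarrow> (\<forall>x. s -` {x} \<in> sets borel)" by blast
  then show ?thesis
    by (simp add: simple_function_def finite_borel_labelling_def)
qed

lemma additive_variation_le_labelling:
  assumes \<nu>: "additive_variation_le \<nu> V" and r: "finite_borel_labelling r"
  shows "(\<Sum>l\<in>range r. norm (\<nu> (r -` {l}))) \<le> V"
proof -
  let ?\<rho> = "(\<lambda>l. r -` {l}) ` range r"
  have inj: "inj_on (\<lambda>l. r -` {l}) (range r)" by (rule inj_onI) blast
  have "partition_on UNIV ?\<rho>"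
    by (rule partition_onI) (auto simp: disjnt_def)
  moreover have "finite ?\<rho>" "?\<rho> \<subseteq> sets borel" using r by (auto simp: finite_borel_labelling_def)
  ultimately have "(\<Sum>E\<in>?\<rho>. norm (\<nu> E)) \<le> V"
    using \<nu> unfolding additive_variation_le_def by blast
  then show ?thesis by (simp add: sum.reindex[OF inj])
qed

lemma additive_variation_le_nonneg:
  assumes "additive_variation_le \<nu> V" shows "0 \<le> V"
proof -
  have r: "finite_borel_labelling (\<lambda>_::'a. ())"
    by (auto simp: finite_borel_labelling_def vimage_const)
  show ?thesis
    using additive_variation_le_labelling[OF assms r] by (meson norm_ge_zero order_trans sum_nonneg)
qed

lemma additive_variation_le_add:
  assumes "additive_variation_le \<nu> V" "additive_variation_le \<mu> W"
  shows "additive_variation_le (\<lambda>A. \<nu> A + \<mu> A) (V + W)"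
  unfolding additive_variation_le_def
proof (intro conjI ballI allI impI)
  fix A B :: "'a set" assume "A \<in> sets borel" "B \<in> sets borel" "A \<inter> B = {}"
  then show "\<nu> (A \<union> B) + \<mu> (A \<union> B) = \<nu> A + \<mu> A + (\<nu> B + \<mu> B)"
    using assms by (simp add: additive_variation_le_def)
next
  fix \<rho> :: "'a set set" assume "finite \<rho>" "\<rho> \<subseteq> sets borel" "partition_on UNIV \<rho>"
  then have "(\<Sum>E\<in>\<rho>. norm (\<nu> E)) \<le> V" "(\<Sum>E\<in>\<rho>. norm (\<mu> E)) \<le> W"
    using assms by (auto simp: additive_variation_le_def)
  moreover have "(\<Sum>E\<in>\<rho>. norm (\<nu> E + \<mu> E)) \<le> (\<Sum>E\<in>\<rho>. norm (\<nu> E) + norm (\<mu> E))"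
    by (intro sum_mono norm_triangle_ineq)
  ultimately show "(\<Sum>E\<in>\<rho>. norm (\<nu> E + \<mu> E)) \<le> V + W"
    by (simp add: sum.distrib)
qed

section \<open>Integrals of continuous functions against vector measures\<close>

text \<open>
  By compactness finitely many continuous functions can be sampled on a finite Borel partition with
  uniformly small error: \<open>r\<close> sends a point to the sample point of its cell.
\<close>

lemma sampling_labelling_exists:
  fixes F :: "'i \<Rightarrow> 'g::topological_space \<Rightarrow> 'b::metric_space"
  assumes comp: "compact (UNIV :: 'g set)" and I: "finite I"
    and cont: "\<And>i. i \<in> I \<Longrightarrow> continuous_on UNIV (F i)" and \<epsilon>: "0 < \<epsilon>"
  obtains r :: "'g \<Rightarrow> 'g" where "finite_borel_labelling r"
    "\<And>i t. i \<in> I \<Longrightarrow> dist (F i (r t)) (F i t) < \<epsilon>"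
proof -
  define U where "U x = {t. \<forall>i\<in>I. dist (F i x) (F i t) < \<epsilon>}" for x
  have "open (U x)" for x
  proof -
    have "U x = (\<Inter>i\<in>I. {t. dist (F i x) (F i t) < \<epsilon>})" by (auto simp: U_def)
    moreover have "open {t. dist (F i x) (F i t) < \<epsilon>}" if "i \<in> I" for i
      by (intro open_Collect_less continuous_intros cont that)
    ultimately show ?thesis using I by auto
  qed
  note opU = this
  have xU: "x \<in> U x" for x using \<epsilon> by (simp add: U_def)
  obtain C where C: "finite C" "UNIV \<subseteq> (\<Union>x\<in>C. U x)"
  proof (rule compactE_image[OF comp, of UNIV U])
    show "UNIV \<subseteq> (\<Union>x\<in>UNIV. U x)" using xU by auto
  qed (use opU in auto)
  obtain xs where xs: "set xs = C" using finite_list[OF C(1)] by blast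
  \<comment> \<open>The finite cover is made disjoint by sending a point to the first set of the list that contains it.\<close>
  define k where "k t = (LEAST k. k < length xs \<and> t \<in> U (xs ! k))" for t
  have k: "k t < length xs \<and> t \<in> U (xs ! k t)" for t
  proof -
    obtain x where "x \<in> set xs" "t \<in> U x" using C(2) xs by blast
    then have "\<exists>k. k < length xs \<and> t \<in> U (xs ! k)"
      by (auto simp: in_set_conv_nth)
    then show ?thesis unfolding k_def by (rule LeastI_ex)
  qed
  have kmin: "t \<notin> U (xs ! j)" if "j < k t" for j t
  proof -
    have "\<not> (j < length xs \<and> t \<in> U (xs ! j))"
      using that unfolding k_def by (rule not_less_Least)
    then show ?thesis using that k[of t] by auto
  qed
  have "finite_borel_labelling k"
    unfolding finite_borel_labelling_def
  proof (intro conjI allI)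
    have "range k \<subseteq> {..<length xs}" using k by auto
    then show "finite (range k)" by (rule finite_subset) simp
    fix l
    have "k -` {l} = (if l < length xs then U (xs ! l) - (\<Union>j<l. U (xs ! j)) else {})"
      (is "_ = ?R")
    proof (intro Set.set_eqI iffI)
      fix t assume "t \<in> k -` {l}"
      then have "k t = l" by simp
      then show "t \<in> ?R" using k[of t] kmin[of _ t] by auto
    next
      fix t assume "t \<in> ?R"
      then have l: "l < length xs" "t \<in> U (xs ! l)" "\<And>j. j < l \<Longrightarrow> t \<notin> U (xs ! j)"
        by (auto split: if_splits)
      have "\<not> l < k t" "\<not> k t < l" using kmin[of l t] k[of t] l(2) l(3)[of "k t"] by blast+
      then have "k t = l" by linarith
      then show "t \<in> k -` {l}" by simp
    qed
    then show "k -` {l} \<in> sets borel"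
      using opU by (auto intro!: sets.Diff borel_open open_UN)
  qed
  then have "finite_borel_labelling (\<lambda>t. xs ! k t)" by (rule labelling_comp)
  moreover have "dist (F i (xs ! k t)) (F i t) < \<epsilon>" if "i \<in> I" for i t
    using k[of t] that by (auto simp: U_def)
  ultimately show ?thesis by (rule that)
qed

context operator_space
begin

lemma smul_bounded_linear: "bounded_linear (smul c)"
proof (rule bounded_linear_intro[of _ "cmod c"])
  fix x y r
  show "smul c (x + y) = smul c x + smul c y" by (rule scale_right_distrib)
  show "smul c (r *\<^sub>R x) = r *\<^sub>R smul c x"
    by (simp add: smul_of_real[symmetric] scale_left_commute)
  show "norm (smul c x) \<le> norm x * cmod c" by (simp add: norm_smul)
qed

lemma vm_simple_integral_factor:
  assumes \<nu>: "additive_variation_le \<nu> V" and r: "finite_borel_labelling r"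
    and s: "\<And>t. s t = \<phi> (r t)"
  shows "vm_simple_integral smul borel \<nu> s = (\<Sum>l\<in>range r. smul (\<phi> l) (\<nu> (r -` {l})))"
proof -
  have fin: "finite (range r)" using r by (simp add: finite_borel_labelling_def)
  have ran: "range s = \<phi> ` range r" using s by auto
  have "\<nu> (s -` {c}) = (\<Sum>l\<in>{l\<in>range r. \<phi> l = c}. \<nu> (r -` {l}))" for c
  proof -
    have "s -` {c} = (\<Union>l\<in>{l\<in>range r. \<phi> l = c}. r -` {l})" using s by auto
    also have "\<nu> \<dots> = (\<Sum>l\<in>{l\<in>range r. \<phi> l = c}. \<nu> (r -` {l}))"
      using fin r by (intro additive_variation_le_Union[OF \<nu>])
        (auto simp: finite_borel_labelling_def disjoint_family_on_def)
    finally show ?thesis .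
  qed
  then have "vm_simple_integral smul borel \<nu> s =
      (\<Sum>c\<in>\<phi> ` range r. \<Sum>l\<in>{l\<in>range r. \<phi> l = c}. smul (\<phi> l) (\<nu> (r -` {l})))"
    by (simp add: vm_simple_integral_def ran scale_sum_right)
  also have "\<dots> = (\<Sum>l\<in>range r. smul (\<phi> l) (\<nu> (r -` {l})))"
    by (rule sum.image_gen[symmetric, OF fin])
  finally show ?thesis .
qed

lemma vm_simple_integral_diff_bound:
  assumes \<nu>: "additive_variation_le \<nu> V"
    and s: "simple_function borel s" and s': "simple_function borel s'"
    and le: "\<And>t. cmod (s t - s' t) \<le> \<delta>"
  shows "norm (vm_simple_integral smul borel \<nu> s - vm_simple_integral smul borel \<nu> s') \<le> \<delta> * V"
proof -
  define r where "r t = (s t, s' t)" for t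
  have r: "finite_borel_labelling r"
    unfolding r_def using s s' by (intro labelling_Pair) (auto simp: simple_function_borel_iff_labelling)
  have \<delta>: "0 \<le> \<delta>" using le by (meson norm_ge_zero order_trans)
  have "vm_simple_integral smul borel \<nu> s - vm_simple_integral smul borel \<nu> s' =
      (\<Sum>l\<in>range r. smul (fst l - snd l) (\<nu> (r -` {l})))"
    using vm_simple_integral_factor[OF \<nu> r, of s fst] vm_simple_integral_factor[OF \<nu> r, of s' snd]
    by (simp add: r_def scale_left_diff_distrib sum_subtractf)
  also have "norm \<dots> \<le> (\<Sum>l\<in>range r. \<delta> * norm (\<nu> (r -` {l})))"
  proof (rule sum_norm_le)
    fix l assume "l \<in> range r"
    then have "cmod (fst l - snd l) \<le> \<delta>" using le by (auto simp: r_def)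
    then show "norm (smul (fst l - snd l) (\<nu> (r -` {l}))) \<le> \<delta> * norm (\<nu> (r -` {l}))"
      by (simp add: norm_smul mult_right_mono)
  qed
  also have "\<dots> \<le> \<delta> * V"
    using additive_variation_le_labelling[OF \<nu> r] \<delta>
    by (simp add: sum_distrib_left[symmetric] mult_left_mono)
  finally show ?thesis .
qed

text \<open>
  The integral of simple functions is Lipschitz in the uniform norm, with the variation as constant;
  this passes to the limit.
\<close>

lemma vm_has_integral_near_simple:
  assumes \<nu>: "additive_variation_le \<nu> V" and x: "vm_has_integral smul borel \<nu> g x"
    and s: "simple_function borel s" and le: "\<And>t. cmod (g t - s t) \<le> \<delta>"
  shows "norm (x - vm_simple_integral smul borel \<nu> s) \<le> \<delta> * V"
proof (rule field_le_epsilon)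
  fix e :: real assume e: "0 < e"
  obtain u where u: "\<And>n. simple_function borel (u n)" "uniform_limit UNIV u g sequentially"
    "(\<lambda>n. vm_simple_integral smul borel \<nu> (u n)) \<longlonglongrightarrow> x"
    using x by (auto simp: vm_has_integral_def)
  have V: "0 \<le> V" by (rule additive_variation_le_nonneg[OF \<nu>])
  \<comment> \<open>The summand 1 covers the case that the variation bound is zero; likewise in the proofs below.\<close>
  define d where "d = e / (2 * (V + 1))"
  have d: "0 < d" "d * V \<le> e / 2" using e V by (auto simp: d_def field_simps)
  have "\<forall>\<^sub>F n in sequentially. \<forall>t\<in>UNIV. dist (u n t) (g t) < d"
    using u(2) d(1) by (rule uniform_limitD)
  moreover have "\<forall>\<^sub>F n in sequentially. dist (vm_simple_integral smul borel \<nu> (u n)) x < e / 2"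
    using u(3) e by (intro tendstoD) auto
  ultimately have "\<forall>\<^sub>F n in sequentially. (\<forall>t\<in>UNIV. dist (u n t) (g t) < d) \<and>
      dist (vm_simple_integral smul borel \<nu> (u n)) x < e / 2"
    by (rule eventually_conj)
  then obtain n where n: "\<And>t. dist (u n t) (g t) < d"
    "dist (vm_simple_integral smul borel \<nu> (u n)) x < e / 2"
    by (auto simp: eventually_sequentially)
  have "cmod (u n t - s t) \<le> d + \<delta>" for t
    using n(1)[of t] le[of t] norm_triangle_ineq[of "u n t - g t" "g t - s t"]
    by (simp add: dist_norm)
  then have "norm (vm_simple_integral smul borel \<nu> (u n) - vm_simple_integral smul borel \<nu> s) \<le> (d + \<delta>) * V"
    by (rule vm_simple_integral_diff_bound[OF \<nu> u(1) s])
  then show "norm (x - vm_simple_integral smul borel \<nu> s) \<le> \<delta> * V + e"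
    using n(2) d(2) norm_triangle_ineq[of "x - vm_simple_integral smul borel \<nu> (u n)"
        "vm_simple_integral smul borel \<nu> (u n) - vm_simple_integral smul borel \<nu> s"]
    by (simp add: dist_norm norm_minus_commute distrib_right)
qed

lemma vm_has_integral_exists:
  fixes g :: "'g::topological_space \<Rightarrow> complex"
  assumes comp: "compact (UNIV :: 'g set)" and \<nu>: "additive_variation_le \<nu> V"
    and g: "continuous_on UNIV g"
  shows "\<exists>x. vm_has_integral smul borel \<nu> g x"
proof -
  have "\<exists>s. simple_function borel s \<and> (\<forall>t. cmod (g t - s t) \<le> 1 / real (Suc n))" for n
  proof -
    obtain r :: "'g \<Rightarrow> 'g" where r: "finite_borel_labelling r"
      "\<And>t. dist (g (r t)) (g t) < 1 / real (Suc n)"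
      using sampling_labelling_exists[OF comp, of "{()}" "\<lambda>_. g" "1 / real (Suc n)"] g by auto
    have "simple_function borel (\<lambda>t. g (r t))"
      unfolding simple_function_borel_iff_labelling by (rule labelling_comp[OF r(1)])
    moreover have "cmod (g t - g (r t)) \<le> 1 / real (Suc n)" for t
      using r(2)[of t] by (simp add: dist_norm norm_minus_commute)
    ultimately show ?thesis by blast
  qed
  then obtain s where s: "\<And>n. simple_function borel (s n)"
    "\<And>n t. cmod (g t - s n t) \<le> 1 / real (Suc n)" by metis
  let ?I = "\<lambda>n. vm_simple_integral smul borel \<nu> (s n)"
  have V: "0 \<le> V" by (rule additive_variation_le_nonneg[OF \<nu>])
  have "uniform_limit UNIV s g sequentially"
  proof (rule uniform_limitI)
    fix e :: real assume "0 < e"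
    then obtain N where N: "1 / real (Suc N) < e" by (metis nat_approx_posE)
    have "dist (s n t) (g t) < e" if "N \<le> n" for n t
    proof -
      have "1 / real (Suc n) \<le> 1 / real (Suc N)" using that by (simp add: frac_le)
      then show ?thesis using s(2)[of t n] N by (simp add: dist_norm norm_minus_commute)
    qed
    then show "\<forall>\<^sub>F n in sequentially. \<forall>t\<in>UNIV. dist (s n t) (g t) < e"
      by (auto simp: eventually_sequentially)
  qed
  moreover have "Cauchy ?I"
  proof (rule CauchyI)
    fix e :: real assume e: "0 < e"
    define d where "d = e / (2 * (V + 1))"
    have d: "0 < d" "2 * d * V < e" using e V by (auto simp: d_def field_simps)
    obtain N where N: "1 / real (Suc N) < d" using d(1) by (metis nat_approx_posE)
    show "\<exists>M. \<forall>m\<ge>M. \<forall>n\<ge>M. norm (?I m - ?I n) < e"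
    proof (intro exI allI impI)
      fix m n assume "N \<le> m" "N \<le> n"
      then have "1 / real (Suc m) \<le> 1 / real (Suc N)" "1 / real (Suc n) \<le> 1 / real (Suc N)"
        by (simp_all add: frac_le)
      then have sd: "cmod (g t - s m t) \<le> d" "cmod (g t - s n t) \<le> d" for t
        using s(2)[of t m] s(2)[of t n] N by linarith+
      have "cmod (s m t - s n t) \<le> 2 * d" for t
        using norm_triangle_ineq4[of "g t - s n t" "g t - s m t"] sd[of t] by simp
      then have "norm (?I m - ?I n) \<le> 2 * d * V"
        by (rule vm_simple_integral_diff_bound[OF \<nu> s(1) s(1)])
      then show "norm (?I m - ?I n) < e" using d(2) by linarith
    qed
  qed
  then have "convergent ?I" by (rule Cauchy_convergent)
  then obtain x where "?I \<longlonglongrightarrow> x" unfolding convergent_def by (rule exE)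
  ultimately have "vm_has_integral smul borel \<nu> g x"
    unfolding vm_has_integral_def by (intro exI[of _ s] conjI allI s(1)) simp_all
  then show ?thesis ..
qed

text \<open>
  The one estimate through which the integral is used from here on: it covers existence and
  uniqueness of the limit defining \<open>vm_integral\<close>, and replaces the integral by a finite sum with
  an error controlled by the variation.
\<close>

lemma vm_integral_near_sampling:
  fixes g :: "'g::topological_space \<Rightarrow> complex"
  assumes comp: "compact (UNIV :: 'g set)" and \<nu>: "additive_variation_le \<nu> V"
    and g: "continuous_on UNIV g" and r: "finite_borel_labelling r"
    and le: "\<And>t. dist (g (r t)) (g t) < \<delta>"
  shows "norm (vm_integral smul borel \<nu> g - (\<Sum>l\<in>range r. smul (g l) (\<nu> (r -` {l})))) \<le> \<delta> * V"
proof -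
  obtain x where x: "vm_has_integral smul borel \<nu> g x"
    using vm_has_integral_exists[OF comp \<nu> g] by blast
  have "y = x" if y: "vm_has_integral smul borel \<nu> g y" for y
  proof -
    obtain u where u: "\<And>n. simple_function borel (u n)" "uniform_limit UNIV u g sequentially"
      "(\<lambda>n. vm_simple_integral smul borel \<nu> (u n)) \<longlonglongrightarrow> x"
      using x by (auto simp: vm_has_integral_def)
    have V: "0 \<le> V" by (rule additive_variation_le_nonneg[OF \<nu>])
    have "(\<lambda>n. vm_simple_integral smul borel \<nu> (u n)) \<longlonglongrightarrow> y"
    proof (rule tendstoI)
      fix e :: real assume e: "0 < e"
      define d where "d = e / (2 * (V + 1))"
      have d: "0 < d" "d * V < e"
        using e V mult_nonneg_nonneg[of V e] by (auto simp: d_def field_simps intro: add_nonneg_pos)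
      have "\<forall>\<^sub>F n in sequentially. \<forall>t\<in>UNIV. dist (u n t) (g t) < d"
        using u(2) d(1) by (rule uniform_limitD)
      then show "\<forall>\<^sub>F n in sequentially. dist (vm_simple_integral smul borel \<nu> (u n)) y < e"
      proof eventually_elim
        case (elim n)
        then have "cmod (g t - u n t) \<le> d" for t
          by (simp add: dist_norm norm_minus_commute less_imp_le)
        then have "norm (y - vm_simple_integral smul borel \<nu> (u n)) \<le> d * V"
          by (rule vm_has_integral_near_simple[OF \<nu> y u(1)])
        then show ?case using d(2) by (simp add: dist_norm norm_minus_commute)
      qed
    qed
    from this u(3) show ?thesis by (rule LIMSEQ_unique)
  qed
  with x have "vm_integral smul borel \<nu> g = x"
    unfolding vm_integral_def by (rule the_equality)
  moreover have "norm (x - vm_simple_integral smul borel \<nu> (\<lambda>t. g (r t))) \<le> \<delta> * V"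
  proof (rule vm_has_integral_near_simple[OF \<nu> x])
    show "simple_function borel (\<lambda>t. g (r t))"
      unfolding simple_function_borel_iff_labelling by (rule labelling_comp[OF r])
    show "cmod (g t - g (r t)) \<le> \<delta>" for t
      using le[of t] by (simp add: dist_norm norm_minus_commute)
  qed
  moreover have "vm_simple_integral smul borel \<nu> (\<lambda>t. g (r t)) = (\<Sum>l\<in>range r. smul (g l) (\<nu> (r -` {l})))"
    by (rule vm_simple_integral_factor[OF \<nu> r]) (rule refl)
  ultimately show ?thesis by (simp only:)
qed

lemma vm_integral_add_measure:
  fixes g :: "'g::topological_space \<Rightarrow> complex"
  assumes comp: "compact (UNIV :: 'g set)" and \<nu>: "additive_variation_le \<nu> V"
    and \<mu>: "additive_variation_le \<mu> W" and g: "continuous_on UNIV g"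
  shows "vm_integral smul borel (\<lambda>A. \<nu> A + \<mu> A) g =
    vm_integral smul borel \<nu> g + vm_integral smul borel \<mu> g"
proof -
  let ?D = "vm_integral smul borel (\<lambda>A. \<nu> A + \<mu> A) g -
    (vm_integral smul borel \<nu> g + vm_integral smul borel \<mu> g)"
  have VW: "0 \<le> V" "0 \<le> W" using \<nu> \<mu> additive_variation_le_nonneg by blast+
  have "norm ?D \<le> 0"
  proof (rule field_le_epsilon)
    fix e :: real assume e: "0 < e"
    define \<delta> where "\<delta> = e / (2 * (V + W) + 1)"
    have \<delta>: "0 < \<delta>" "2 * \<delta> * (V + W) \<le> e" using e VW by (auto simp: \<delta>_def field_simps add_pos_nonneg)
    obtain r :: "'g \<Rightarrow> 'g" where r: "finite_borel_labelling r" "\<And>t. dist (g (r t)) (g t) < \<delta>"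
      using sampling_labelling_exists[OF comp, of "{()}" "\<lambda>_. g" \<delta>] g \<delta> by auto
    let ?S = "\<lambda>\<nu>. \<Sum>l\<in>range r. smul (g l) (\<nu> (r -` {l}))"
    have S: "?S (\<lambda>A. \<nu> A + \<mu> A) = ?S \<nu> + ?S \<mu>"
      by (simp add: scale_right_distrib sum.distrib)
    note near = vm_integral_near_sampling[OF comp _ g r]
    have "?D = (vm_integral smul borel (\<lambda>A. \<nu> A + \<mu> A) g - ?S (\<lambda>A. \<nu> A + \<mu> A))
        - (vm_integral smul borel \<nu> g - ?S \<nu>) - (vm_integral smul borel \<mu> g - ?S \<mu>)"
      unfolding S by simp
    also have "norm \<dots> \<le> \<delta> * (V + W) + \<delta> * V + \<delta> * W"
      by (intro norm_triangle_le_diff add_mono near \<nu> \<mu> additive_variation_le_add)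
    finally show "norm ?D \<le> 0 + e" using \<delta>(2) by (simp add: algebra_simps)
  qed
  then show ?thesis by simp
qed

end

section \<open>Matrices over an operator space\<close>

lemma index_mat_mult_vec:
  assumes "v \<in> carrier_vec e" "i < d"
  shows "vec_index (mat d e f *\<^sub>v v) i = (\<Sum>j<e. f (i, j) * vec_index v j)"
  using assms by (simp add: scalar_prod_def atLeast0LessThan)

lemma cvec_norm_nonneg: "0 \<le> cvec_norm v"
  by (simp add: cvec_norm_def sum_nonneg)

lemma cvec_norm_square: "(cvec_norm v)\<^sup>2 = (\<Sum>i<dim_vec v. (cmod (vec_index v i))\<^sup>2)"
  by (simp add: cvec_norm_def sum_nonneg)

lemma mat_op_norm_le:
  assumes "\<And>v. v \<in> carrier_vec (dim_col A) \<Longrightarrow> cvec_norm v \<le> 1 \<Longrightarrow> cvec_norm (A *\<^sub>v v) \<le> C"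
  shows "mat_op_norm A \<le> C"
  unfolding mat_op_norm_def
proof (rule cSUP_least)
  have "0\<^sub>v (dim_col A) \<in> {v \<in> carrier_vec (dim_col A). cvec_norm v \<le> 1}"
    by (simp add: cvec_norm_def)
  then show "{v \<in> carrier_vec (dim_col A). cvec_norm v \<le> 1} \<noteq> {}" by blast
qed (use assms in auto)

lemma mat_op_norm_one: "0 \<le> mat_op_norm (1\<^sub>m n)" "mat_op_norm (1\<^sub>m n) \<le> 1"
proof -
  show "mat_op_norm (1\<^sub>m n) \<le> 1" by (rule mat_op_norm_le) simp
  have "cvec_norm (1\<^sub>m n *\<^sub>v 0\<^sub>v n) \<le> mat_op_norm (1\<^sub>m n)"
    unfolding mat_op_norm_def
    by (rule cSUP_upper) (auto simp: cvec_norm_def intro!: bdd_aboveI[of _ 1])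
  then show "0 \<le> mat_op_norm (1\<^sub>m n)" using cvec_norm_nonneg order_trans by blast
qed

lemma mat_op_norm_elementary:
  assumes a: "a < d" and b: "b < d"
  shows "mat_op_norm (mat d d (\<lambda>ij. if ij = (a, b) then 1 else 0)) \<le> 1"
proof (rule mat_op_norm_le)
  let ?E = "mat d d (\<lambda>ij. if ij = (a, b) then 1 else 0 :: complex)"
  fix v :: "complex vec" assume v: "v \<in> carrier_vec (dim_col ?E)" "cvec_norm v \<le> 1"
  have vd: "v \<in> carrier_vec d" using v(1) by simp
  have "vec_index (?E *\<^sub>v v) i = (if i = a then vec_index v b else 0)" if "i < d" for i
  proof -
    have "vec_index (?E *\<^sub>v v) i = (\<Sum>j<d. (if (i, j) = (a, b) then 1 else 0) * vec_index v j)"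
      by (rule index_mat_mult_vec[OF vd that])
    also have "\<dots> = (\<Sum>j<d. if j = b then (if i = a then vec_index v b else 0) else 0)"
      by (intro sum.cong) auto
    finally show ?thesis using b by (simp add: sum.delta)
  qed
  then have "(cvec_norm (?E *\<^sub>v v))\<^sup>2 = (\<Sum>i<d. if i = a then (cmod (vec_index v b))\<^sup>2 else 0)"
    unfolding cvec_norm_square by (intro sum.cong) auto
  also have "\<dots> = (cmod (vec_index v b))\<^sup>2" using a by (simp add: sum.delta)
  also have "\<dots> \<le> (cvec_norm v)\<^sup>2"
    unfolding cvec_norm_square using vd b by (intro member_le_sum) auto
  finally have "cvec_norm (?E *\<^sub>v v) \<le> cvec_norm v"
    using cvec_norm_nonneg by (rule power2_le_imp_le)
  then show "cvec_norm (?E *\<^sub>v v) \<le> 1" using v(2) by simp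
qed

lemma index_mat_adjoint:
  fixes A :: "complex mat"
  assumes "i < dim_col A" "j < dim_row A"
  shows "mat_adjoint A $$ (i, j) = cnj (A $$ (j, i))"
  using assms by (simp add: mat_adjoint_def mat_of_rows_def conjugate_complex_def)

lemma mat_adjoint_dims [simp]:
  "dim_row (mat_adjoint A) = dim_col (A :: complex mat)" "dim_col (mat_adjoint A) = dim_row A"
  by (simp_all add: mat_adjoint_def)

lemma mat_adjoint_carrier [simp]:
  "(A :: complex mat) \<in> carrier_mat n k \<Longrightarrow> mat_adjoint A \<in> carrier_mat k n"
  by auto

lemma unitary_mat_rows:
  assumes U: "unitary_mat d U" and i: "i < d" and j: "j < d"
  shows "(\<Sum>k<d. U $$ (i, k) * cnj (U $$ (j, k))) = (if i = j then 1 else 0)"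
proof -
  have dims: "dim_row U = d" "dim_col U = d"
    using U by (auto simp: unitary_mat_def)
  have "(U * mat_adjoint U) $$ (i, j) = (1\<^sub>m d) $$ (i, j)"
    using U by (auto simp: unitary_mat_def)
  then show ?thesis
    using i j dims by (simp add: scalar_prod_def index_mat_adjoint atLeast0LessThan)
qed

text \<open>
  Expanding the squares leaves inner products of the rows of \<open>U\<close>, which are orthonormal.
\<close>

lemma unitary_adjoint_isometry:
  assumes U: "unitary_mat d U"
  shows "(\<Sum>i<d. (cmod (\<Sum>j<d. cnj (U $$ (j, i)) * w j))\<^sup>2) = (\<Sum>j<d. (cmod (w j))\<^sup>2)"
proof -
  have "complex_of_real (\<Sum>i<d. (cmod (\<Sum>j<d. cnj (U $$ (j, i)) * w j))\<^sup>2) =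
      (\<Sum>i<d. (\<Sum>j<d. cnj (U $$ (j, i)) * w j) * cnj (\<Sum>k<d. cnj (U $$ (k, i)) * w k))"
    by (simp only: of_real_sum complex_norm_square)
  also have "\<dots> = (\<Sum>i<d. \<Sum>j<d. \<Sum>k<d. (w j * cnj (w k)) * (U $$ (k, i) * cnj (U $$ (j, i))))"
    by (simp add: sum_product mult_ac)
  also have "\<dots> = (\<Sum>j<d. \<Sum>k<d. \<Sum>i<d. (w j * cnj (w k)) * (U $$ (k, i) * cnj (U $$ (j, i))))"
    by (subst sum.swap) (intro sum.cong refl sum.swap)
  also have "\<dots> = (\<Sum>j<d. \<Sum>k<d. (w j * cnj (w k)) * (if k = j then 1 else 0))"
    by (simp only: sum_distrib_left[symmetric]) (intro sum.cong refl arg_cong2[where f="(*)"] unitary_mat_rows[OF U]; simp)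
  also have "\<dots> = (\<Sum>j<d. w j * cnj (w j))"
    by (simp add: if_distrib sum.delta cong: if_cong)
  also have "\<dots> = complex_of_real (\<Sum>j<d. (cmod (w j))\<^sup>2)"
    by (simp only: of_real_sum complex_norm_square)
  finally show ?thesis by (simp only: of_real_eq_iff)
qed

lemma mat_op_norm_unitary_adjoint:
  assumes U: "unitary_mat d U"
  shows "mat_op_norm (mat d d (\<lambda>(i, j). c * cnj (U $$ (j, i)))) \<le> cmod c"
proof (rule mat_op_norm_le)
  let ?A = "mat d d (\<lambda>(i, j). c * cnj (U $$ (j, i)))"
  fix v :: "complex vec" assume v: "v \<in> carrier_vec (dim_col ?A)" "cvec_norm v \<le> 1"
  have vd: "v \<in> carrier_vec d" using v(1) by simp
  have "(cvec_norm (?A *\<^sub>v v))\<^sup>2 = (\<Sum>i<d. (cmod c)\<^sup>2 * (cmod (\<Sum>j<d. cnj (U $$ (j, i)) * vec_index v j))\<^sup>2)"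
    unfolding cvec_norm_square
    by (intro sum.cong)
      (auto simp del: index_mult_mat_vec simp: index_mat_mult_vec[OF vd] mult.assoc sum_distrib_left[symmetric] norm_mult power_mult_distrib)
  also have "\<dots> = (cmod c * cvec_norm v)\<^sup>2"
    using vd by (simp add: sum_distrib_left[symmetric] unitary_adjoint_isometry[OF U] cvec_norm_square power_mult_distrib)
  finally have "cvec_norm (?A *\<^sub>v v) = cmod c * cvec_norm v"
    by (simp add: cvec_norm_nonneg power2_eq_iff_nonneg)
  also have "\<dots> \<le> cmod c" using v(2) by (simp add: mult_left_le)
  finally show "cvec_norm (?A *\<^sub>v v) \<le> cmod c" .
qed

context operator_space
begin

lemma mnorm_zero: "mnorm (0\<^sub>m n n) = 0"
  using mnorm_eq_0_iff[of "0\<^sub>m n n" n] by simp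

lemma mnorm_nonneg:
  assumes v: "v \<in> carrier_mat n n"
  shows "0 \<le> mnorm v"
proof -
  let ?w = "map_mat (smul (- 1)) v"
  have w: "?w \<in> carrier_mat n n" using v by simp
  have "v + ?w = 0\<^sub>m n n"
    using v by (intro eq_matI) auto
  then have "0 \<le> mnorm v + mnorm ?w"
    using mnorm_triangle[OF v w] by (simp add: mnorm_zero)
  also have "mnorm ?w = mnorm v" using mnorm_smul[OF v, of "- 1"] by simp
  finally show ?thesis by simp
qed

definition scalar_tensor :: "complex mat \<Rightarrow> 'x \<Rightarrow> 'x mat" where
  "scalar_tensor A x = map_mat (\<lambda>c. smul c x) A"

lemma mnorm_tensor_one: "mnorm (scalar_tensor (1\<^sub>m d) x) \<le> norm x"
proof (induction d)
  case 0
  have "scalar_tensor (1\<^sub>m 0) x = 0\<^sub>m 0 0" by (intro eq_matI) (auto simp: scalar_tensor_def)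
  then show ?case by (simp add: mnorm_zero)
next
  case (Suc d)
  have "scalar_tensor (1\<^sub>m (Suc d)) x =
      four_block_mat (mat 1 1 (\<lambda>_. x)) (0\<^sub>m 1 d) (0\<^sub>m d 1) (scalar_tensor (1\<^sub>m d) x)"
    by (intro eq_matI) (auto simp: scalar_tensor_def)
  then have "mnorm (scalar_tensor (1\<^sub>m (Suc d)) x) = max (norm x) (mnorm (scalar_tensor (1\<^sub>m d) x))"
    using mnorm_direct_sum[of "mat 1 1 (\<lambda>_. x)" 1 "scalar_tensor (1\<^sub>m d) x" d] mnorm_one[of x] by (simp add: scalar_tensor_def)
  then show ?case using Suc by simp
qed

text \<open>
  The tensor is the scalar matrix \<open>A\<close> acting from the left on the diagonal matrix with entries \<open>x\<close>, whose
  norm is controlled by the direct sum axiom. The bound on the operator norm is passed as \<open>C\<close>, which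
  avoids showing that the supremum in \<open>mat_op_norm A\<close> is taken over a bounded set.
\<close>

lemma mnorm_tensor_le:
  assumes A: "A \<in> carrier_mat d d" and C: "mat_op_norm A \<le> C" "0 \<le> C"
  shows "mnorm (scalar_tensor A x) \<le> C * norm x"
proof -
  let ?I = "scalar_tensor (1\<^sub>m d) x"
  have I: "?I \<in> carrier_mat d d" by (simp add: scalar_tensor_def)
  have "scalar_mat_action smul A ?I (1\<^sub>m d) = scalar_tensor A x"
  proof (rule eq_matI)
    fix i j assume "i < dim_row (scalar_tensor A x)" "j < dim_col (scalar_tensor A x)"
    then have ij: "i < d" "j < d" using A by (auto simp: scalar_tensor_def)
    have "scalar_mat_action smul A ?I (1\<^sub>m d) $$ (i, j) =
        (\<Sum>k<d. \<Sum>l<d. smul (A $$ (i, k) * (1\<^sub>m d) $$ (l, j)) (smul ((1\<^sub>m d) $$ (k, l)) x))"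
      using A ij by (simp add: scalar_mat_action_def scalar_tensor_def)
    also have "\<dots> = (\<Sum>k<d. \<Sum>l<d. if l = j then (if k = j then smul (A $$ (i, j)) x else 0) else 0)"
      using ij by (intro sum.cong) auto
    also have "\<dots> = smul (A $$ (i, j)) x" using ij by (simp add: sum.delta)
    finally show "scalar_mat_action smul A ?I (1\<^sub>m d) $$ (i, j) = scalar_tensor A x $$ (i, j)"
      using A ij by (simp add: scalar_tensor_def)
  qed (use A in \<open>auto simp: scalar_mat_action_def scalar_tensor_def\<close>)
  then have "mnorm (scalar_tensor A x) \<le> mat_op_norm A * mnorm ?I * mat_op_norm (1\<^sub>m d)"
    using mnorm_action[OF A I, of "1\<^sub>m d"] by simp
  also have "\<dots> \<le> C * mnorm ?I * mat_op_norm (1\<^sub>m d)"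
    using C mnorm_nonneg[OF I] mat_op_norm_one by (intro mult_right_mono) auto
  also have "\<dots> \<le> C * norm x * 1"
    using C mnorm_nonneg[OF I] mat_op_norm_one mnorm_tensor_one[of d x]
    by (intro mult_mono) auto
  finally show ?thesis by simp
qed

lemma mnorm_sum_le:
  assumes "finite K"
  shows "mnorm (mat d d (\<lambda>ij. \<Sum>k\<in>K. f k ij)) \<le> (\<Sum>k\<in>K. mnorm (mat d d (f k)))"
  using assms
proof (induction K)
  case empty
  have "mat d d (\<lambda>ij. 0) = 0\<^sub>m d d" by (intro eq_matI) auto
  then have "mnorm (mat d d (\<lambda>ij. 0)) = 0" using mnorm_zero by metis
  then show ?case by simp
next
  case (insert k K)
  have "mat d d (\<lambda>ij. \<Sum>k\<in>insert k K. f k ij) = mat d d (f k) + mat d d (\<lambda>ij. \<Sum>k\<in>K. f k ij)"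
    using insert by (intro eq_matI) auto
  also have "mnorm \<dots> \<le> mnorm (mat d d (f k)) + mnorm (mat d d (\<lambda>ij. \<Sum>k\<in>K. f k ij))"
    by (rule mnorm_triangle) auto
  finally show ?case using insert by simp
qed

text \<open>
  A crude bound by matrix units. It depends on \<open>d\<close>, and serves only to see that entrywise
  convergence for a fixed representation implies convergence in norm.
\<close>

lemma mnorm_le_sum_entries:
  assumes "\<And>i j. i < d \<Longrightarrow> j < d \<Longrightarrow> norm (f (i, j)) \<le> C"
  shows "mnorm (mat d d f) \<le> real d * real d * C"
proof -
  let ?E = "\<lambda>ab. mat d d (\<lambda>ij. if ij = ab then 1 else 0 :: complex)"
  let ?K = "{..<d} \<times> {..<d}"
  have "mat d d f = mat d d (\<lambda>ij. \<Sum>ab\<in>?K. smul (if ij = ab then 1 else 0) (f ab))"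
    (is "_ = ?R")
  proof (rule eq_matI)
    fix i j assume "i < dim_row ?R" "j < dim_col ?R"
    then have ij: "i < d" "j < d" by auto
    have "(\<Sum>ab\<in>?K. smul (if (i, j) = ab then 1 else 0) (f ab)) =
        (\<Sum>ab\<in>?K. if ab = (i, j) then f (i, j) else 0)"
      by (intro sum.cong) auto
    also have "\<dots> = f (i, j)" using ij by (simp add: sum.delta)
    finally show "mat d d f $$ (i, j) = ?R $$ (i, j)" using ij by simp
  qed auto
  also have "mnorm \<dots> \<le> (\<Sum>ab\<in>?K. mnorm (mat d d (\<lambda>ij. smul (if ij = ab then 1 else 0) (f ab))))"
    by (rule mnorm_sum_le) simp
  also have "\<dots> \<le> (\<Sum>ab\<in>?K. C)"
  proof (rule sum_mono)
    fix ab assume ab: "ab \<in> ?K"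
    have "mat d d (\<lambda>ij. smul (if ij = ab then 1 else 0) (f ab)) = scalar_tensor (?E ab) (f ab)"
      by (intro eq_matI) (auto simp: scalar_tensor_def)
    moreover have "mnorm (scalar_tensor (?E ab) (f ab)) \<le> 1 * norm (f ab)"
      using ab mat_op_norm_elementary[of "fst ab" d "snd ab"] by (intro mnorm_tensor_le) auto
    ultimately show "mnorm (mat d d (\<lambda>ij. smul (if ij = ab then 1 else 0) (f ab))) \<le> C"
      using assms[of "fst ab" "snd ab"] ab by auto
  qed
  finally show ?thesis by simp
qed

text \<open>
  On a fine enough sampling partition the coefficient is, up to an error \<open>R\<close> with small entries, a sum
  \<open>S\<close> of tensors of \<open>\<pi>(l)*/d\<close> with the value of \<open>\<nu>\<close> on the cell of \<open>l\<close>. Because the sample values are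
  exact unitaries, each tensor has norm at most that of its vector, which makes the bound independent
  of the dimension.
\<close>

lemma mnorm_fourier_coeff_le:
  fixes \<nu> :: "'g::topological_group_add set \<Rightarrow> 'x"
  assumes comp: "compact (UNIV :: 'g set)" and \<nu>: "additive_variation_le \<nu> V"
    and \<pi>: "unitary_rep \<pi>" and d0: "0 < rep_dim \<pi>"
  shows "mnorm (fourier_coeff smul \<nu> \<pi>) \<le> V"
proof (rule field_le_epsilon)
  fix e :: real assume e: "0 < e"
  define d where "d = rep_dim \<pi>"
  have d: "0 < d" "1 \<le> real d" using d0 by (auto simp: d_def)
  have V: "0 \<le> V" by (rule additive_variation_le_nonneg[OF \<nu>])
  define \<delta> where "\<delta> = e / (real d * real d * V + 1)"
  have \<delta>: "0 < \<delta>" "real d * real d * (\<delta> * V) \<le> e"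
  proof -
    have p: "0 < real d * real d * V + 1" using V by (simp add: add_nonneg_pos)
    then show "0 < \<delta>" using e by (simp add: \<delta>_def)
    have "real d * real d * (\<delta> * V) = \<delta> * (real d * real d * V)" by simp
    also have "\<dots> \<le> \<delta> * (real d * real d * V + 1)" using \<open>0 < \<delta>\<close> by (intro mult_left_mono) auto
    also have "\<dots> = e" using p by (simp add: \<delta>_def)
    finally show "real d * real d * (\<delta> * V) \<le> e" .
  qed
  define F where "F = (\<lambda>(i, j) t. cnj (\<pi> t $$ (j, i)))"
  have F: "continuous_on UNIV (F ij)" if "ij \<in> {..<d} \<times> {..<d}" for ij
    using \<pi> that unfolding F_def unitary_rep_def d_def
    by (auto intro!: continuous_on_cnj)
  obtain r :: "'g \<Rightarrow> 'g" where r: "finite_borel_labelling r"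
    "\<And>ij t. ij \<in> {..<d} \<times> {..<d} \<Longrightarrow> dist (F ij (r t)) (F ij t) < \<delta>"
    by (rule sampling_labelling_exists[OF comp finite_cartesian_product[OF finite_lessThan finite_lessThan] F \<delta>(1)])
      (assumption, blast)
  let ?E = "\<lambda>l. \<nu> (r -` {l})"
  define err where "err ij = vm_integral smul borel \<nu> (F ij) - (\<Sum>l\<in>range r. smul (F ij l) (?E l))" for ij
  have err: "norm (err ij) \<le> \<delta> * V" if "ij \<in> {..<d} \<times> {..<d}" for ij
    unfolding err_def by (rule vm_integral_near_sampling[OF comp \<nu> F[OF that] r(1) r(2)[OF that]])
  define S where "S = mat d d (\<lambda>ij. \<Sum>l\<in>range r. smul (1 / of_nat d * F ij l) (?E l))"
  define R where "R = mat d d (\<lambda>ij. smul (1 / of_nat d) (err ij))"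
  have "fourier_coeff smul \<nu> \<pi> = S + R"
  proof (rule eq_matI)
    fix i j assume "i < dim_row (S + R)" "j < dim_col (S + R)"
    then have ij: "i < d" "j < d" by (auto simp: R_def)
    have "fourier_coeff smul \<nu> \<pi> $$ (i, j) = smul (1 / of_nat d) (vm_integral smul borel \<nu> (F (i, j)))"
      using ij by (simp add: fourier_coeff_def d_def F_def)
    also have "\<dots> = (S + R) $$ (i, j)"
    proof -
      have "vm_integral smul borel \<nu> (F (i, j)) = (\<Sum>l\<in>range r. smul (F (i, j) l) (?E l)) + err (i, j)"
        by (simp add: err_def)
      then show ?thesis
        using ij by (simp add: S_def R_def scale_right_distrib scale_sum_right)
    qed
    finally show "fourier_coeff smul \<nu> \<pi> $$ (i, j) = (S + R) $$ (i, j)" .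
  qed (auto simp: fourier_coeff_def R_def d_def)
  moreover have "mnorm (S + R) \<le> mnorm S + mnorm R"
    by (rule mnorm_triangle) (auto simp: S_def R_def)
  moreover have "mnorm R \<le> real d * real d * (\<delta> * V)"
    unfolding R_def
  proof (rule mnorm_le_sum_entries)
    fix i j assume "i < d" "j < d"
    then have "norm (err (i, j)) \<le> \<delta> * V" by (intro err) auto
    moreover have "norm (smul (1 / of_nat d) (err (i, j))) \<le> norm (err (i, j))"
      using d by (simp add: norm_smul norm_divide divide_le_eq mult_left_le mult_le_cancel_left1)
    ultimately show "norm (smul (1 / of_nat d) (err (i, j))) \<le> \<delta> * V" by linarith
  qed
  moreover have "mnorm S \<le> V"
  proof -
    have "finite (range r)" using r(1) by (simp add: finite_borel_labelling_def)
    then have "mnorm S \<le> (\<Sum>l\<in>range r. mnorm (mat d d (\<lambda>ij. smul (1 / of_nat d * F ij l) (?E l))))"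
      unfolding S_def by (rule mnorm_sum_le)
    also have "\<dots> \<le> (\<Sum>l\<in>range r. norm (?E l))"
    proof (rule sum_mono)
      fix l
      let ?A = "mat d d (\<lambda>(i, j). 1 / of_nat d * cnj (\<pi> l $$ (j, i)))"
      have "unitary_mat d (\<pi> l)" using \<pi> by (simp add: unitary_rep_def d_def)
      then have "mat_op_norm ?A \<le> cmod (1 / of_nat d)" by (rule mat_op_norm_unitary_adjoint)
      also have "\<dots> \<le> 1" using d by (simp add: norm_divide)
      finally have "mnorm (scalar_tensor ?A (?E l)) \<le> 1 * norm (?E l)"
        by (intro mnorm_tensor_le) auto
      moreover have "scalar_tensor ?A (?E l) = mat d d (\<lambda>ij. smul (1 / of_nat d * F ij l) (?E l))"
        by (intro eq_matI) (auto simp: scalar_tensor_def F_def)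
      ultimately show "mnorm (mat d d (\<lambda>ij. smul (1 / of_nat d * F ij l) (?E l))) \<le> norm (?E l)"
        by simp
    qed
    also have "\<dots> \<le> V" by (rule additive_variation_le_labelling[OF \<nu> r(1)])
    finally show ?thesis .
  qed
  ultimately show "mnorm (fourier_coeff smul \<nu> \<pi>) \<le> V + e" using \<delta>(2) by simp
qed

lemma fourier_coeff_add_measure:
  fixes \<nu> :: "'g::topological_group_add set \<Rightarrow> 'x"
  assumes comp: "compact (UNIV :: 'g set)" and \<nu>: "additive_variation_le \<nu> V"
    and \<mu>: "additive_variation_le \<mu> W" and \<pi>: "unitary_rep \<pi>"
  shows "fourier_coeff smul (\<lambda>A. \<nu> A + \<mu> A) \<pi> = fourier_coeff smul \<nu> \<pi> + fourier_coeff smul \<mu> \<pi>"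
proof (rule eq_matI)
  fix i j
  assume "i < dim_row (fourier_coeff smul \<nu> \<pi> + fourier_coeff smul \<mu> \<pi>)"
    "j < dim_col (fourier_coeff smul \<nu> \<pi> + fourier_coeff smul \<mu> \<pi>)"
  then have ij: "i < rep_dim \<pi>" "j < rep_dim \<pi>" by (auto simp: fourier_coeff_def)
  have "continuous_on UNIV (\<lambda>t. cnj (\<pi> t $$ (j, i)))"
    using \<pi> ij by (auto simp: unitary_rep_def intro!: continuous_on_cnj)
  then show "fourier_coeff smul (\<lambda>A. \<nu> A + \<mu> A) \<pi> $$ (i, j) =
      (fourier_coeff smul \<nu> \<pi> + fourier_coeff smul \<mu> \<pi>) $$ (i, j)"
    using ij vm_integral_add_measure[OF comp \<nu> \<mu>] by (simp add: fourier_coeff_def scale_right_distrib)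
qed (auto simp: fourier_coeff_def)

end

section \<open>Schur orthogonality for inequivalent representations\<close>

lemma unitary_repD:
  assumes "unitary_rep \<pi>"
  shows "unitary_mat (rep_dim \<pi>) (\<pi> t)" "\<pi> t \<in> carrier_mat (rep_dim \<pi>) (rep_dim \<pi>)"
    "\<pi> (s + t) = \<pi> s * \<pi> t"
    "i < rep_dim \<pi> \<Longrightarrow> j < rep_dim \<pi> \<Longrightarrow> continuous_on UNIV (\<lambda>t. \<pi> t $$ (i, j))"
  using assms by (auto simp: unitary_rep_def unitary_mat_def)

lemma unitary_rep_adjoint:
  assumes \<pi>: "unitary_rep \<pi>"
  shows "mat_adjoint (\<pi> t) = \<pi> (- t)"
proof -
  let ?d = "rep_dim \<pi>"
  note c = unitary_repD(2)[OF \<pi>]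
  have u: "mat_adjoint (\<pi> s) * \<pi> s = 1\<^sub>m ?d" for s
    using unitary_repD(1)[OF \<pi>, of s] by (simp add: unitary_mat_def)
  have cancel: "mat_adjoint (\<pi> s) * (\<pi> s * \<pi> t) = \<pi> t" for s t
    using u[of s] c[of t] assoc_mult_mat[OF mat_adjoint_carrier[OF c[of s]] c[of s] c[of t]] by simp
  have "\<pi> 0 = 1\<^sub>m ?d"
    using cancel[of 0 0] u[of 0] by (simp flip: unitary_repD(3)[OF \<pi>])
  then have "\<pi> t * \<pi> (- t) = 1\<^sub>m ?d"
    by (simp flip: unitary_repD(3)[OF \<pi>])
  then show ?thesis using cancel[of t "- t"] c[of t] by simp
qed

lemma mat_adjoint_mult:
  fixes A B :: "complex mat"
  assumes A: "A \<in> carrier_mat n k" and B: "B \<in> carrier_mat k l"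
  shows "mat_adjoint (A * B) = mat_adjoint B * mat_adjoint A"
proof (rule eq_matI)
  fix i j assume "i < dim_row (mat_adjoint B * mat_adjoint A)" "j < dim_col (mat_adjoint B * mat_adjoint A)"
  then have ij: "i < l" "j < n" using A B by auto
  have "mat_adjoint (A * B) $$ (i, j) = cnj (\<Sum>p<k. A $$ (j, p) * B $$ (p, i))"
    using A B ij by (simp add: index_mat_adjoint scalar_prod_def atLeast0LessThan)
  also have "\<dots> = (\<Sum>p<k. mat_adjoint B $$ (i, p) * mat_adjoint A $$ (p, j))"
    using A B ij by (simp add: index_mat_adjoint mult.commute)
  also have "\<dots> = (mat_adjoint B * mat_adjoint A) $$ (i, j)"
    using A B ij by (simp add: scalar_prod_def atLeast0LessThan)
  finally show "mat_adjoint (A * B) $$ (i, j) = (mat_adjoint B * mat_adjoint A) $$ (i, j)" .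
qed (use A B in auto)

lemma mat_adjoint_adjoint: "mat_adjoint (mat_adjoint A) = (A :: complex mat)"
  by (rule eq_matI) (simp_all add: index_mat_adjoint)

lemma mat_adjoint_smult: "mat_adjoint (c \<cdot>\<^sub>m A) = cnj c \<cdot>\<^sub>m mat_adjoint (A :: complex mat)"
  by (rule eq_matI) (simp_all add: index_mat_adjoint)

text \<open>
  Schur's lemma: an eigenspace of an operator commuting with the representation is invariant, hence
  everything.
\<close>

lemma schur_commutant_scalar:
  assumes \<rho>: "irreducible_unitary_rep \<rho>" and B: "B \<in> carrier_mat (rep_dim \<rho>) (rep_dim \<rho>)"
    and comm: "\<And>t. B * \<rho> t = \<rho> t * B"
  shows "\<exists>k. B = k \<cdot>\<^sub>m 1\<^sub>m (rep_dim \<rho>)"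
proof -
  let ?e = "rep_dim \<rho>"
  have u: "unitary_rep \<rho>" and e: "0 < ?e"
    and irr: "\<And>W. invariant_subspace \<rho> W \<Longrightarrow> W = {0\<^sub>v ?e} \<or> W = carrier_vec ?e"
    using \<rho> by (auto simp: irreducible_unitary_rep_def)
  obtain k v where v: "v \<in> carrier_vec ?e" "v \<noteq> 0\<^sub>v ?e" "B *\<^sub>v v = k \<cdot>\<^sub>v v"
    using spectrum_non_empty[OF B e] B by (auto simp: spectrum_def eigenvalue_def eigenvector_def)
  define W where "W = {w \<in> carrier_vec ?e. B *\<^sub>v w = k \<cdot>\<^sub>v w}"
  have "invariant_subspace \<rho> W"
    unfolding invariant_subspace_def
  proof (intro conjI ballI allI)
    show "W \<subseteq> carrier_vec ?e" by (auto simp: W_def)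
    show "0\<^sub>v ?e \<in> W" using B by (auto simp: W_def)
  next
    fix w w' assume "w \<in> W" "w' \<in> W"
    then show "w + w' \<in> W"
      using B by (auto simp: W_def mult_add_distrib_mat_vec[OF B] smult_add_distrib_vec)
  next
    fix c w assume "w \<in> W"
    then show "c \<cdot>\<^sub>v w \<in> W"
      using B by (auto simp: W_def mult_mat_vec[OF B] smult_smult_assoc mult.commute)
  next
    fix t w assume w: "w \<in> W"
    have \<rho>t: "\<rho> t \<in> carrier_mat ?e ?e" by (rule unitary_repD(2)[OF u])
    have wc: "w \<in> carrier_vec ?e" and Bw: "B *\<^sub>v w = k \<cdot>\<^sub>v w" using w by (auto simp: W_def)
    have "B *\<^sub>v (\<rho> t *\<^sub>v w) = (B * \<rho> t) *\<^sub>v w" using assoc_mult_mat_vec[OF B \<rho>t wc] by simp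
    also have "\<dots> = \<rho> t *\<^sub>v (B *\<^sub>v w)" unfolding comm using assoc_mult_mat_vec[OF \<rho>t B wc] by simp
    also have "\<dots> = k \<cdot>\<^sub>v (\<rho> t *\<^sub>v w)" unfolding Bw by (rule mult_mat_vec[OF \<rho>t wc])
    finally show "\<rho> t *\<^sub>v w \<in> W" using \<rho>t wc by (auto simp: W_def)
  qed
  then have W: "W = carrier_vec ?e" using irr v by (fastforce simp: W_def)
  have "B = k \<cdot>\<^sub>m 1\<^sub>m ?e"
  proof (rule eq_matI)
    fix i j assume "i < dim_row (k \<cdot>\<^sub>m 1\<^sub>m ?e)" "j < dim_col (k \<cdot>\<^sub>m 1\<^sub>m ?e)"
    then have ij: "i < ?e" "j < ?e" by auto
    have "unit_vec ?e j \<in> W" unfolding W by simp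
    then have "vec_index (B *\<^sub>v unit_vec ?e j) i = vec_index (k \<cdot>\<^sub>v unit_vec ?e j) i" by (simp add: W_def)
    then show "B $$ (i, j) = (k \<cdot>\<^sub>m 1\<^sub>m ?e) $$ (i, j)"
      using B ij by (simp add: scalar_prod_right_unit[of j _ "row B i"])
  qed (use B in auto)
  then show ?thesis ..
qed

text \<open>
  An intertwiner \<open>T\<close> makes both \<open>T*T\<close> and \<open>TT*\<close> commute with the representations, so both are scalar.
  Comparing \<open>(TT*)T\<close> with \<open>T(T*T)\<close> shows that the two scalars agree, and comparing traces that the
  dimensions do. A positive multiple of \<open>T*\<close> is therefore unitary.
\<close>

lemma schur_intertwiner:
  assumes \<pi>: "irreducible_unitary_rep \<pi>" and \<rho>: "irreducible_unitary_rep \<rho>"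
    and T: "T \<in> carrier_mat (rep_dim \<pi>) (rep_dim \<rho>)"
    and inter: "\<And>t. \<pi> t * T = T * \<rho> t"
    and nz: "T \<noteq> 0\<^sub>m (rep_dim \<pi>) (rep_dim \<rho>)"
  shows "unitarily_equivalent \<pi> \<rho>"
proof -
  let ?d = "rep_dim \<pi>" and ?e = "rep_dim \<rho>"
  have u\<pi>: "unitary_rep \<pi>" and u\<rho>: "unitary_rep \<rho>" and d: "0 < ?d" and e: "0 < ?e"
    using \<pi> \<rho> by (auto simp: irreducible_unitary_rep_def)
  note c\<pi> = unitary_repD(2)[OF u\<pi>] and c\<rho> = unitary_repD(2)[OF u\<rho>]
  define S where "S = mat_adjoint T"
  have S: "S \<in> carrier_mat ?e ?d" using T by (simp add: S_def)
  have S_inter: "\<rho> t * S = S * \<pi> t" for t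
  proof -
    have "mat_adjoint (\<pi> (- t) * T) = mat_adjoint (T * \<rho> (- t))" by (simp add: inter)
    then show ?thesis
      by (simp add: mat_adjoint_mult[OF c\<pi> T] mat_adjoint_mult[OF T c\<rho>] unitary_rep_adjoint[OF u\<pi>]
          unitary_rep_adjoint[OF u\<rho>] S_def)
  qed
  have ST: "S * T \<in> carrier_mat ?e ?e" and TS: "T * S \<in> carrier_mat ?d ?d" using S T by auto
  have "(S * T) * \<rho> t = \<rho> t * (S * T)" for t
  proof -
    have "(S * T) * \<rho> t = S * (\<pi> t * T)" using assoc_mult_mat[OF S T c\<rho>] by (simp add: inter)
    also have "\<dots> = (S * \<pi> t) * T" using assoc_mult_mat[OF S c\<pi> T] by simp
    also have "\<dots> = \<rho> t * (S * T)" using assoc_mult_mat[OF c\<rho> S T] by (simp flip: S_inter)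
    finally show ?thesis .
  qed
  then obtain \<kappa> where \<kappa>: "S * T = \<kappa> \<cdot>\<^sub>m 1\<^sub>m ?e" using schur_commutant_scalar[OF \<rho> ST] by blast
  have "(T * S) * \<pi> t = \<pi> t * (T * S)" for t
  proof -
    have "(T * S) * \<pi> t = T * (\<rho> t * S)" using assoc_mult_mat[OF T S c\<pi>] by (simp add: S_inter)
    also have "\<dots> = (T * \<rho> t) * S" using assoc_mult_mat[OF T c\<rho> S] by simp
    also have "\<dots> = \<pi> t * (T * S)" using assoc_mult_mat[OF c\<pi> T S] by (simp flip: inter)
    finally show ?thesis .
  qed
  then obtain \<mu> where \<mu>: "T * S = \<mu> \<cdot>\<^sub>m 1\<^sub>m ?d" using schur_commutant_scalar[OF \<pi> TS] by blast
  obtain i0 j0 where ij0: "i0 < ?d" "j0 < ?e" "T $$ (i0, j0) \<noteq> 0"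
    using nz T by (auto simp: mat_eq_iff)
  have "\<mu> \<cdot>\<^sub>m T = (T * S) * T" using T by (simp add: \<mu> mult_smult_assoc_mat[OF one_carrier_mat T])
  also have "\<dots> = T * (S * T)" by (rule assoc_mult_mat[OF T S T])
  also have "\<dots> = \<kappa> \<cdot>\<^sub>m T" using T by (simp add: \<kappa> mult_smult_distrib[OF T one_carrier_mat])
  finally have "(\<mu> \<cdot>\<^sub>m T) $$ (i0, j0) = (\<kappa> \<cdot>\<^sub>m T) $$ (i0, j0)" by simp
  then have \<mu>\<kappa>: "\<mu> = \<kappa>" using ij0 T by simp
  \<comment> \<open>The common trace of \<open>T*T\<close> and \<open>TT*\<close>.\<close>
  define N where "N = (\<Sum>i<?d. \<Sum>j<?e. (cmod (T $$ (i, j)))\<^sup>2)"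
  have "\<kappa> = (\<Sum>i<?d. complex_of_real ((cmod (T $$ (i, j)))\<^sup>2))" if j: "j < ?e" for j
  proof -
    have "\<kappa> = (S * T) $$ (j, j)" using j by (simp add: \<kappa>)
    also have "\<dots> = (\<Sum>i<?d. cnj (T $$ (i, j)) * T $$ (i, j))"
      using S T j by (simp add: scalar_prod_def atLeast0LessThan S_def index_mat_adjoint)
    also have "\<dots> = (\<Sum>i<?d. complex_of_real ((cmod (T $$ (i, j)))\<^sup>2))"
      by (simp only: complex_norm_square mult.commute)
    finally show ?thesis .
  qed
  then have "(\<Sum>j<?e. \<kappa>) = (\<Sum>j<?e. \<Sum>i<?d. complex_of_real ((cmod (T $$ (i, j)))\<^sup>2))"
    by (intro sum.cong) auto
  also have "\<dots> = (\<Sum>i<?d. \<Sum>j<?e. complex_of_real ((cmod (T $$ (i, j)))\<^sup>2))" by (rule sum.swap)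
  also have "\<dots> = of_real N" by (simp only: N_def of_real_sum)
  finally have \<kappa>N: "of_nat ?e * \<kappa> = of_real N" by simp
  have "\<mu> = (\<Sum>j<?e. complex_of_real ((cmod (T $$ (i, j)))\<^sup>2))" if i: "i < ?d" for i
  proof -
    have "\<mu> = (T * S) $$ (i, i)" using i by (simp add: \<mu>)
    also have "\<dots> = (\<Sum>j<?e. T $$ (i, j) * cnj (T $$ (i, j)))"
      using S T i by (simp add: scalar_prod_def atLeast0LessThan S_def index_mat_adjoint)
    also have "\<dots> = (\<Sum>j<?e. complex_of_real ((cmod (T $$ (i, j)))\<^sup>2))"
      by (simp only: complex_norm_square)
    finally show ?thesis .
  qed
  then have "(\<Sum>i<?d. \<mu>) = (\<Sum>i<?d. \<Sum>j<?e. complex_of_real ((cmod (T $$ (i, j)))\<^sup>2))"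
    by (intro sum.cong) auto
  also have "\<dots> = of_real N" by (simp only: N_def of_real_sum)
  finally have \<mu>N: "of_nat ?d * \<mu> = of_real N" by simp
  have "0 < (cmod (T $$ (i0, j0)))\<^sup>2" using ij0 by simp
  also have "\<dots> \<le> (\<Sum>j<?e. (cmod (T $$ (i0, j)))\<^sup>2)" using ij0 by (intro member_le_sum) auto
  also have "\<dots> \<le> N"
    unfolding N_def using ij0 by (intro member_le_sum) (auto intro: sum_nonneg)
  finally have N: "0 < N" .
  have de: "?d = ?e"
    using \<kappa>N \<mu>N \<mu>\<kappa> N by (metis less_numeral_extra(3) mult_cancel_right mult_zero_right of_nat_eq_iff of_real_eq_0_iff)
  \<comment> \<open>As \<open>\<kappa> = N / ?e\<close>, this makes the multiple of \<open>T*\<close> by \<open>c\<close> unitary.\<close>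
  define c where "c = 1 / sqrt (N / ?e)"
  have cl: "complex_of_real c * (complex_of_real c * \<kappa>) = 1"
  proof -
    have "\<kappa> = of_real (N / ?e)" using \<kappa>N e by (simp add: field_simps)
    moreover have "c * (c * (N / ?e)) = 1" using N e by (simp add: c_def real_sqrt_mult_self field_simps flip: real_sqrt_mult)
    ultimately show ?thesis by (metis of_real_1 of_real_mult)
  qed
  define U where "U = complex_of_real c \<cdot>\<^sub>m S"
  have U: "U \<in> carrier_mat ?e ?d" using S by (simp add: U_def)
  have U': "mat_adjoint U = complex_of_real c \<cdot>\<^sub>m T"
    using mat_adjoint_smult[of _ S] mat_adjoint_adjoint by (simp add: U_def S_def)
  have "mat_adjoint U * U = complex_of_real c \<cdot>\<^sub>m (complex_of_real c \<cdot>\<^sub>m (T * S))"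
    unfolding U' unfolding U_def
    using mult_smult_assoc_mat[OF T smult_carrier_mat[OF S]] mult_smult_distrib[OF T S] by simp
  also have "\<dots> = 1\<^sub>m ?d" using cl by (intro eq_matI) (auto simp: \<mu> \<mu>\<kappa>)
  finally have 1: "mat_adjoint U * U = 1\<^sub>m ?d" .
  have "U * mat_adjoint U = complex_of_real c \<cdot>\<^sub>m (complex_of_real c \<cdot>\<^sub>m (S * T))"
    unfolding U' unfolding U_def
    using mult_smult_assoc_mat[OF S smult_carrier_mat[OF T]] mult_smult_distrib[OF S T] by simp
  also have "\<dots> = 1\<^sub>m ?e" using cl by (intro eq_matI) (auto simp: \<kappa>)
  finally have 2: "U * mat_adjoint U = 1\<^sub>m ?e" .
  have "U * \<pi> t = \<rho> t * U" for t
    unfolding U_def using mult_smult_assoc_mat[OF S c\<pi>] mult_smult_distrib[OF c\<rho> S] S_inter by simp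
  moreover have "unitary_mat ?d U" using U 1 2 de by (simp add: unitary_mat_def)
  ultimately show ?thesis unfolding unitarily_equivalent_def using de by blast
qed

text \<open>
  Classes are compared through representatives, which requires that unitary equivalence of
  irreducible representations is an equivalence relation.
\<close>

lemma unitary_dual_eq_if_equivalent:
  assumes c: "c \<in> unitary_dual" "c' \<in> unitary_dual" and mem: "\<pi> \<in> c" "\<rho> \<in> c'"
    and eq: "unitarily_equivalent \<pi> \<rho>"
  shows "c = c'"
proof -
  let ?I = "{\<pi> :: 'a \<Rightarrow> complex mat. irreducible_unitary_rep \<pi>}"
  let ?R = "{(\<pi>, \<rho>). irreducible_unitary_rep \<pi> \<and> irreducible_unitary_rep \<rho> \<and>
    unitarily_equivalent \<pi> (\<rho> :: 'a \<Rightarrow> complex mat)}"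
  have dim: "\<pi> t \<in> carrier_mat (rep_dim \<pi>) (rep_dim \<pi>)" if "irreducible_unitary_rep \<pi>"
    for \<pi> :: "'a \<Rightarrow> complex mat" and t
    using that unitary_repD(2) by (auto simp: irreducible_unitary_rep_def)
  have "equiv ?I ?R"
  proof (rule equivI)
    show "?R \<subseteq> ?I \<times> ?I" by auto
    show "refl_on ?I ?R"
    proof (rule refl_onI)
      fix \<pi> :: "'a \<Rightarrow> complex mat" assume \<pi>: "\<pi> \<in> ?I"
      have "mat_adjoint (1\<^sub>m n :: complex mat) = 1\<^sub>m n" for n
        by (rule eq_matI) (auto simp: index_mat_adjoint)
      then have "unitary_mat n (1\<^sub>m n)" for n by (simp add: unitary_mat_def)
      moreover have "1\<^sub>m (rep_dim \<pi>) * \<pi> t = \<pi> t * 1\<^sub>m (rep_dim \<pi>)" for t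
        using dim[of \<pi> t] \<pi> by simp
      ultimately show "(\<pi>, \<pi>) \<in> ?R" using \<pi> by (auto simp: unitarily_equivalent_def)
    qed
    show "sym ?R"
    proof (rule symI)
      fix \<pi> \<rho> :: "'a \<Rightarrow> complex mat" assume "(\<pi>, \<rho>) \<in> ?R"
      then have irr: "irreducible_unitary_rep \<pi>" "irreducible_unitary_rep \<rho>"
        and "unitarily_equivalent \<pi> \<rho>" by auto
      then obtain U where d: "rep_dim \<pi> = rep_dim \<rho>" and U: "unitary_mat (rep_dim \<rho>) U"
        and UI: "\<And>t. U * \<pi> t = \<rho> t * U"
        by (auto simp: unitarily_equivalent_def)
      let ?d = "rep_dim \<rho>" and ?V = "mat_adjoint U"
      have Uc: "U \<in> carrier_mat ?d ?d" and Vc: "?V \<in> carrier_mat ?d ?d"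
        and 1: "?V * U = 1\<^sub>m ?d" "U * ?V = 1\<^sub>m ?d"
        using U by (auto simp: unitary_mat_def)
      have "?V * \<rho> t = \<pi> t * ?V" for t
      proof -
        have c: "\<pi> t \<in> carrier_mat ?d ?d" "\<rho> t \<in> carrier_mat ?d ?d" using dim irr d by metis+
        have "?V * \<rho> t = ?V * (\<rho> t * U) * ?V"
          using c Uc Vc 1 by (simp add: assoc_mult_mat[of _ ?d ?d _ ?d _ ?d])
        also have "\<dots> = (?V * U) * (\<pi> t * ?V)"
          using c Uc Vc by (simp add: assoc_mult_mat[of _ ?d ?d _ ?d _ ?d] flip: UI)
        also have "\<dots> = \<pi> t * ?V" using c Vc 1 by simp
        finally show ?thesis .
      qed
      moreover have "unitary_mat ?d ?V"
        using Uc Vc 1 by (simp add: unitary_mat_def mat_adjoint_adjoint)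
      ultimately show "(\<rho>, \<pi>) \<in> ?R" using irr d by (auto simp: unitarily_equivalent_def)
    qed
    show "trans ?R"
    proof (rule transI)
      fix \<pi> \<rho> \<sigma> :: "'a \<Rightarrow> complex mat" assume "(\<pi>, \<rho>) \<in> ?R" "(\<rho>, \<sigma>) \<in> ?R"
      then have irr: "irreducible_unitary_rep \<pi>" "irreducible_unitary_rep \<rho>" "irreducible_unitary_rep \<sigma>"
        and "unitarily_equivalent \<pi> \<rho>" "unitarily_equivalent \<rho> \<sigma>" by auto
      then obtain U V where d: "rep_dim \<pi> = rep_dim \<sigma>" "rep_dim \<rho> = rep_dim \<sigma>"
        and U: "unitary_mat (rep_dim \<sigma>) U" and UI: "\<And>t. U * \<pi> t = \<rho> t * U"
        and V: "unitary_mat (rep_dim \<sigma>) V" and VI: "\<And>t. V * \<rho> t = \<sigma> t * V"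
        by (auto simp: unitarily_equivalent_def)
      let ?d = "rep_dim \<sigma>"
      have Uc: "U \<in> carrier_mat ?d ?d" "V \<in> carrier_mat ?d ?d"
        "mat_adjoint U \<in> carrier_mat ?d ?d" "mat_adjoint V \<in> carrier_mat ?d ?d"
        and 1: "mat_adjoint U * U = 1\<^sub>m ?d" "U * mat_adjoint U = 1\<^sub>m ?d"
          "mat_adjoint V * V = 1\<^sub>m ?d" "V * mat_adjoint V = 1\<^sub>m ?d"
        using U V by (auto simp: unitary_mat_def)
      note assoc = assoc_mult_mat[of _ ?d ?d _ ?d _ ?d]
      have "V * U * \<pi> t = \<sigma> t * (V * U)" for t
      proof -
        have c: "\<pi> t \<in> carrier_mat ?d ?d" "\<rho> t \<in> carrier_mat ?d ?d" "\<sigma> t \<in> carrier_mat ?d ?d"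
          using dim irr d by metis+
        have "V * U * \<pi> t = (V * \<rho> t) * U" using c Uc by (simp add: assoc UI)
        also have "\<dots> = \<sigma> t * (V * U)" using c Uc by (simp add: assoc VI)
        finally show ?thesis .
      qed
      moreover have "unitary_mat ?d (V * U)"
      proof -
        have "mat_adjoint U * mat_adjoint V * (V * U) = mat_adjoint U * ((mat_adjoint V * V) * U)"
          using Uc by (simp add: assoc)
        moreover have "(V * U) * (mat_adjoint U * mat_adjoint V) = V * ((U * mat_adjoint U) * mat_adjoint V)"
          using assoc_mult_mat[OF Uc(2,1) mult_carrier_mat[OF Uc(3,4)]] assoc_mult_mat[OF Uc(1,3,4)] by simp
        ultimately show ?thesis
          unfolding unitary_mat_def mat_adjoint_mult[OF Uc(2,1)] using Uc 1 by simp
      qed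
      ultimately show "(\<pi>, \<sigma>) \<in> ?R" using irr d by (auto simp: unitarily_equivalent_def)
    qed
  qed
  moreover have "irreducible_unitary_rep \<pi>" "irreducible_unitary_rep \<rho>"
    using c mem by (auto simp: unitary_dual_def quotient_def)
  ultimately show ?thesis
    using quotient_eq_iff[of ?I ?R c c' \<pi> \<rho>] c mem eq by (auto simp: unitary_dual_def)
qed

lemma unitary_dual_irreducible:
  "c \<in> unitary_dual \<Longrightarrow> \<pi> \<in> c \<Longrightarrow> irreducible_unitary_rep \<pi>"
  by (auto simp: unitary_dual_def quotient_def)

lemma borel_measurable_cnj [measurable]:
  "f \<in> borel_measurable M \<Longrightarrow> (\<lambda>x. cnj (f x)) \<in> borel_measurable M"
  by (rule borel_measurable_continuous_on) (intro continuous_intros)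

text \<open>
  The preimage of a set under translation by \<open>s\<close> is its image under translation by \<open>-s\<close>, so the
  measure coincides with its image measure.
\<close>

lemma haar_integral_translate:
  fixes m :: "'g::{topological_group_add,t2_space} measure" and f :: "'g \<Rightarrow> complex"
  assumes m: "normalized_haar_measure m" and f: "f \<in> borel_measurable borel"
  shows "(\<integral>t. f (s + t) \<partial>m) = (\<integral>t. f t \<partial>m)"
proof -
  have sets: "sets m = sets borel" using m by (simp add: normalized_haar_measure_def)
  have space: "space m = UNIV" using sets_eq_imp_space_eq[OF sets] by simp
  have "continuous_on UNIV (\<lambda>y::'g. s + y)" by (intro continuous_intros)
  then have "(\<lambda>y. s + y) \<in> borel_measurable borel" by (rule borel_measurable_continuous_onI)
  then have meas: "(\<lambda>y. s + y) \<in> measurable m m" by (simp add: measurable_cong_sets[OF sets sets])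
  have "distr m m (\<lambda>y. s + y) = m"
  proof (rule measure_eqI)
    fix A assume "A \<in> sets (distr m m (\<lambda>y. s + y))"
    then have A: "A \<in> sets m" by simp
    have "(\<lambda>y. s + y) -` A = (\<lambda>y. - s + y) ` A"
    proof (intro Set.set_eqI iffI)
      fix y assume "y \<in> (\<lambda>y. s + y) -` A"
      then show "y \<in> (\<lambda>y. - s + y) ` A" by (intro image_eqI[of _ _ "s + y"]) (auto simp: add.assoc[symmetric])
    qed (auto simp: add.assoc[symmetric])
    then have "emeasure m ((\<lambda>y. s + y) -` A) = emeasure m A"
      using m A sets by (simp add: normalized_haar_measure_def)
    then show "emeasure (distr m m (\<lambda>y. s + y)) A = emeasure m A"
      using emeasure_distr[OF meas A] by (simp add: space)
  qed simp
  moreover have "(\<integral>t. f t \<partial>distr m m (\<lambda>y. s + y)) = (\<integral>t. f (s + t) \<partial>m)"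
    by (rule integral_distr[OF meas]) (use f sets in \<open>simp add: measurable_cong_sets[OF sets refl]\<close>)
  ultimately show ?thesis by simp
qed

lemma unitary_mat_entry_le_1:
  assumes U: "unitary_mat d U" and ij: "i < d" "j < d"
  shows "cmod (U $$ (i, j)) \<le> 1"
proof -
  have "complex_of_real (\<Sum>k<d. (cmod (U $$ (i, k)))\<^sup>2) = 1"
    using unitary_mat_rows[OF U ij(1) ij(1)] by (simp only: of_real_sum complex_norm_square) simp
  then have "(\<Sum>k<d. (cmod (U $$ (i, k)))\<^sup>2) = 1" by (simp only: of_real_eq_1_iff)
  moreover have "(cmod (U $$ (i, j)))\<^sup>2 \<le> (\<Sum>k<d. (cmod (U $$ (i, k)))\<^sup>2)"
    using ij by (intro member_le_sum) auto
  ultimately show ?thesis by (simp add: power2_le_iff_abs_le abs_square_le_1)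
qed

lemma haar_finite_measure:
  assumes "normalized_haar_measure m"
  shows "finite_measure m" "sets m = sets borel" "space m = UNIV" "measure m UNIV = 1"
    "f \<in> borel_measurable borel \<Longrightarrow> f \<in> borel_measurable m"
proof -
  show sets: "sets m = sets borel" using assms by (simp add: normalized_haar_measure_def)
  then show space: "space m = UNIV" using sets_eq_imp_space_eq by fastforce
  have "emeasure m UNIV = 1" using assms by (simp add: normalized_haar_measure_def)
  then show "finite_measure m" "measure m UNIV = 1"
    by (auto intro!: finite_measureI simp: space measure_def)
  show "f \<in> borel_measurable borel \<Longrightarrow> f \<in> borel_measurable m"
    by (simp add: measurable_cong_sets[OF sets refl])
qed

lemma haar_integrable_bounded:
  fixes f :: "'g::{topological_group_add,t2_space} \<Rightarrow> complex"
  assumes "normalized_haar_measure m" "f \<in> borel_measurable borel" "\<And>t. cmod (f t) \<le> C"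
  shows "integrable m f"
  using haar_finite_measure[OF assms(1)] assms(2,3)
  by (intro finite_measure.integrable_const_bound[of _ _ C]) auto

text \<open>
  For fixed columns \<open>k\<close> and \<open>l\<close> the integrals form a matrix \<open>T\<close> in \<open>i\<close> and \<open>j\<close>, the average of
  \<open>\<pi>(t) E \<rho>(t)*\<close> for a matrix unit \<open>E\<close>. Left invariance makes it an intertwiner, so it vanishes by
  Schur's lemma.
\<close>

lemma schur_orthogonality:
  fixes m :: "'g::{topological_group_add,t2_space} measure"
  assumes m: "normalized_haar_measure m"
    and \<pi>: "irreducible_unitary_rep \<pi>" and \<rho>: "irreducible_unitary_rep \<rho>"
    and ineq: "\<not> unitarily_equivalent \<pi> \<rho>"
    and i: "i < rep_dim \<pi>" "k < rep_dim \<pi>" and j: "j < rep_dim \<rho>" "l < rep_dim \<rho>"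
  shows "(\<integral>t. \<pi> t $$ (i, k) * cnj (\<rho> t $$ (j, l)) \<partial>m) = 0"
proof -
  let ?d = "rep_dim \<pi>" and ?e = "rep_dim \<rho>"
  have u\<pi>: "unitary_rep \<pi>" and u\<rho>: "unitary_rep \<rho>"
    using \<pi> \<rho> by (auto simp: irreducible_unitary_rep_def)
  note c\<pi> = unitary_repD(2)[OF u\<pi>] and c\<rho> = unitary_repD(2)[OF u\<rho>]
  have m\<pi>: "(\<lambda>t. \<pi> t $$ (i, k)) \<in> borel_measurable borel" if "i < ?d" "k < ?d" for i k
    using unitary_repD(4)[OF u\<pi>] that by (intro borel_measurable_continuous_onI)
  have m\<rho>: "(\<lambda>t. \<rho> t $$ (i, k)) \<in> borel_measurable borel" if "i < ?e" "k < ?e" for i k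
    using unitary_repD(4)[OF u\<rho>] that by (intro borel_measurable_continuous_onI)
  define f where "f i j t = \<pi> t $$ (i, k) * cnj (\<rho> t $$ (j, l))" for i j t
  have f: "integrable m (f i j)" if "i < ?d" "j < ?e" for i j
  proof (rule haar_integrable_bounded[OF m])
    show "f i j \<in> borel_measurable borel"
      unfolding f_def using m\<pi>[OF that(1) \<open>k < ?d\<close>] m\<rho>[OF that(2) \<open>l < ?e\<close>] by measurable
    show "cmod (f i j t) \<le> 1" for t
      unfolding f_def norm_mult complex_mod_cnj using that i j
      by (intro mult_le_one unitary_mat_entry_le_1[of ?d] unitary_mat_entry_le_1[of ?e]
          unitary_repD(1) u\<pi> u\<rho>) auto
  qed
  define T where "T = mat ?d ?e (\<lambda>(i, j). \<integral>t. f i j t \<partial>m)"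
  have T: "T \<in> carrier_mat ?d ?e" by (simp add: T_def)
  have "\<pi> s * T = T * \<rho> s" for s
  proof (rule eq_matI)
    fix i j assume "i < dim_row (T * \<rho> s)" "j < dim_col (T * \<rho> s)"
    then have ij: "i < ?d" "j < ?e" using c\<rho>[of s] by (auto simp: T_def)
    \<comment> \<open>Translating \<open>h\<close> by \<open>s\<close> moves the factor \<open>s\<close> from the second representation to the first.\<close>
    define h where "h t = \<pi> t $$ (i, k) * cnj (\<rho> (- s + t) $$ (j, l))" for t
    have h: "h t = (\<Sum>q<?e. \<rho> s $$ (q, j) * f i q t)" for t
    proof -
      have "\<rho> (- s + t) $$ (j, l) = (\<Sum>q<?e. \<rho> (- s) $$ (j, q) * \<rho> t $$ (q, l))"
        using c\<rho>[of "- s"] c\<rho>[of t] ij j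
        by (simp add: unitary_repD(3)[OF u\<rho>] scalar_prod_def atLeast0LessThan)
      moreover have "cnj (\<rho> (- s) $$ (j, q)) = \<rho> s $$ (q, j)" if "q < ?e" for q
        using index_mat_adjoint[of j "\<rho> s" q] c\<rho>[of s] that ij by (simp add: unitary_rep_adjoint[OF u\<rho>])
      ultimately show ?thesis
        by (simp add: h_def f_def sum_distrib_left mult_ac)
    qed
    have hs: "h (s + t) = (\<Sum>p<?d. \<pi> s $$ (i, p) * f p j t)" for t
    proof -
      have "\<pi> (s + t) $$ (i, k) = (\<Sum>p<?d. \<pi> s $$ (i, p) * \<pi> t $$ (p, k))"
        using c\<pi>[of s] c\<pi>[of t] ij \<open>k < ?d\<close>
        by (simp add: unitary_repD(3)[OF u\<pi>] scalar_prod_def atLeast0LessThan)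
      then show ?thesis
        by (simp add: h_def f_def sum_distrib_left sum_distrib_right mult_ac add.assoc[symmetric])
    qed
    have "h \<in> borel_measurable borel"
    proof -
      have "f i q \<in> borel_measurable borel" if "q < ?e" for q
        unfolding f_def using m\<pi>[OF ij(1) \<open>k < ?d\<close>] m\<rho>[OF that \<open>l < ?e\<close>] by measurable
      then show ?thesis unfolding h by (intro borel_measurable_sum borel_measurable_times) auto
    qed
    then have "(\<integral>t. h (s + t) \<partial>m) = (\<integral>t. h t \<partial>m)" by (rule haar_integral_translate[OF m])
    moreover have "(\<integral>t. h (s + t) \<partial>m) = (\<pi> s * T) $$ (i, j)"
    proof -
      have "(\<integral>t. h (s + t) \<partial>m) = (\<Sum>p<?d. \<pi> s $$ (i, p) * (\<integral>t. f p j t \<partial>m))"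
        unfolding hs using f ij by (subst Bochner_Integration.integral_sum) auto
      then show ?thesis
        using ij c\<pi>[of s] by (simp add: T_def scalar_prod_def atLeast0LessThan)
    qed
    moreover have "(\<integral>t. h t \<partial>m) = (T * \<rho> s) $$ (i, j)"
    proof -
      have "(\<integral>t. h t \<partial>m) = (\<Sum>q<?e. \<rho> s $$ (q, j) * (\<integral>t. f i q t \<partial>m))"
        unfolding h using f ij by (subst Bochner_Integration.integral_sum) auto
      then show ?thesis
        using ij c\<rho>[of s] by (simp add: T_def scalar_prod_def atLeast0LessThan mult.commute)
    qed
    ultimately show "(\<pi> s * T) $$ (i, j) = (T * \<rho> s) $$ (i, j)" by simp
  qed (use c\<pi>[of s] c\<rho>[of s] in \<open>auto simp: T_def\<close>)
  then have "T = 0\<^sub>m ?d ?e" using schur_intertwiner[OF \<pi> \<rho> T] ineq by blast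
  then have "T $$ (i, j) = 0" using i j by simp
  then show ?thesis using i j by (simp add: T_def f_def)
qed

section \<open>Bessel's inequality and coefficients of indicator functions\<close>

text \<open>
  The functions are orthogonal but only bounded by 1, so the induction subtracts from \<open>h\<close> its
  coefficient times \<open>g l\<close> rather than an orthogonal projection. The squared norm still drops by at
  least the squared modulus of the coefficient, and the other coefficients are unchanged.
\<close>

lemma bessel_inequality:
  fixes h :: "'g::{topological_group_add,t2_space} \<Rightarrow> complex"
  assumes m: "normalized_haar_measure m" and "finite K"
    and "\<And>k. k \<in> K \<Longrightarrow> g k \<in> borel_measurable borel" and "\<And>k t. k \<in> K \<Longrightarrow> cmod (g k t) \<le> 1"
    and "\<And>k l. k \<in> K \<Longrightarrow> l \<in> K \<Longrightarrow> k \<noteq> l \<Longrightarrow> (\<integral>t. g k t * cnj (g l t) \<partial>m) = 0"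
    and "h \<in> borel_measurable borel" and "\<And>t. cmod (h t) \<le> C"
  shows "(\<Sum>k\<in>K. (cmod (\<integral>t. h t * cnj (g k t) \<partial>m))\<^sup>2) \<le> (\<integral>t. (cmod (h t))\<^sup>2 \<partial>m)"
  using assms(2-)
proof (induction K arbitrary: h C)
  case empty
  then show ?case by simp
next
  case (insert l K)
  let ?ip = "\<lambda>f g. \<integral>t. f t * cnj (g t) \<partial>m"
  have gl[measurable]: "g l \<in> borel_measurable borel" and gl1: "\<And>t. cmod (g l t) \<le> 1"
    and h[measurable]: "h \<in> borel_measurable borel" and hC: "\<And>t. cmod (h t) \<le> C"
    using insert.prems by auto
  define a where "a = ?ip h (g l)"
  define h' where "h' t = h t - a * g l t" for t
  have [measurable]: "h' \<in> borel_measurable borel" unfolding h'_def by measurable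
  have h'C: "cmod (h' t) \<le> C + cmod a" for t
  proof -
    have "cmod (a * g l t) \<le> cmod a" using gl1[of t] by (simp add: norm_mult mult_left_le)
    then show ?thesis unfolding h'_def using hC[of t] norm_triangle_ineq4[of "h t" "a * g l t"] by linarith
  qed
  have int: "integrable m (\<lambda>t. u t * cnj (v t))"
    if "u \<in> borel_measurable borel" "v \<in> borel_measurable borel" "\<And>t. cmod (u t) \<le> A" "\<And>t. cmod (v t) \<le> B"
    for u v :: "'g \<Rightarrow> complex" and A B
  proof (rule haar_integrable_bounded[OF m])
    show "(\<lambda>t. u t * cnj (v t)) \<in> borel_measurable borel" using that(1,2) by measurable
    show "cmod (u t * cnj (v t)) \<le> A * B" for t
      unfolding norm_mult complex_mod_cnj
      using that(3,4)[of t] by (intro mult_mono) (auto intro: order_trans[OF norm_ge_zero])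
  qed
  have "?ip h' (g k) = ?ip h (g k)" if k: "k \<in> K" for k
  proof -
    have gk: "g k \<in> borel_measurable borel" "\<And>t. cmod (g k t) \<le> 1" using insert.prems(1,2) k by auto
    have "?ip h' (g k) = ?ip h (g k) - a * ?ip (g l) (g k)"
      unfolding h'_def using int[OF h gk(1) hC gk(2)] int[OF gl gk(1) gl1 gk(2)]
      by (simp add: left_diff_distrib mult.assoc)
    moreover have "l \<noteq> k" using insert.hyps k by auto
    then have "?ip (g l) (g k) = 0" using insert.prems(3)[of l k] k by simp
    ultimately show ?thesis by simp
  qed
  then have "(\<Sum>k\<in>K. (cmod (?ip h (g k)))\<^sup>2) = (\<Sum>k\<in>K. (cmod (?ip h' (g k)))\<^sup>2)" by simp
  also have "\<dots> \<le> (\<integral>t. (cmod (h' t))\<^sup>2 \<partial>m)"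
    using insert.prems h'C by (intro insert.IH) auto
  also have "\<dots> \<le> (\<integral>t. (cmod (h t))\<^sup>2 \<partial>m) - (cmod a)\<^sup>2"
  proof -
    have sq: "complex_of_real (\<integral>t. (cmod (u t))\<^sup>2 \<partial>m) = ?ip u u" for u
      by (simp only: integral_complex_of_real[symmetric] complex_norm_square)
    have ipc: "?ip (g l) h = cnj a"
      unfolding a_def by (subst Bochner_Integration.integral_cnj[symmetric]) (simp add: mult.commute)
    have "?ip h' h' = ?ip h h - cnj a * ?ip h (g l) - a * ?ip (g l) h + a * cnj a * ?ip (g l) (g l)"
    proof -
      have "?ip h' h' = (\<integral>t. h t * cnj (h t) - cnj a * (h t * cnj (g l t)) - a * (g l t * cnj (h t))
          + a * cnj a * (g l t * cnj (g l t)) \<partial>m)"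
        unfolding h'_def by (intro Bochner_Integration.integral_cong) (auto simp: algebra_simps)
      also have "\<dots> = ?ip h h - cnj a * ?ip h (g l) - a * ?ip (g l) h + a * cnj a * ?ip (g l) (g l)"
        using int[OF h h hC hC] int[OF h gl hC gl1] int[OF gl h gl1 hC] int[OF gl gl gl1 gl1] by simp
      finally show ?thesis .
    qed
    also have "\<dots> = complex_of_real ((\<integral>t. (cmod (h t))\<^sup>2 \<partial>m) - 2 * (cmod a)\<^sup>2 + (cmod a)\<^sup>2 * (\<integral>t. (cmod (g l t))\<^sup>2 \<partial>m))"
      unfolding ipc a_def[symmetric] sq[symmetric]
      by (simp add: complex_norm_square algebra_simps flip: of_real_power)
    finally have "(\<integral>t. (cmod (h' t))\<^sup>2 \<partial>m) =
        (\<integral>t. (cmod (h t))\<^sup>2 \<partial>m) - 2 * (cmod a)\<^sup>2 + (cmod a)\<^sup>2 * (\<integral>t. (cmod (g l t))\<^sup>2 \<partial>m)"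
      unfolding sq[symmetric] by (simp only: of_real_eq_iff)
    moreover have "(\<integral>t. (cmod (g l t))\<^sup>2 \<partial>m) \<le> 1"
    proof -
      interpret finite_measure m by (rule haar_finite_measure(1)[OF m])
      have "(\<integral>t. (cmod (g l t))\<^sup>2 \<partial>m) \<le> (\<integral>t. 1 \<partial>m)"
        by (intro integral_mono_AE') (auto simp: gl1 power_le_one)
      then show ?thesis using haar_finite_measure(3,4)[OF m] by simp
    qed
    then have "(cmod a)\<^sup>2 * (\<integral>t. (cmod (g l t))\<^sup>2 \<partial>m) \<le> (cmod a)\<^sup>2" by (simp add: mult_left_le)
    ultimately show ?thesis by linarith
  qed
  finally show ?case using insert.hyps by (simp add: a_def)
qed

text \<open>
  The Fourier coefficient of the scalar measure with density the indicator function of \<open>B\<close>.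
\<close>

definition indicator_coeff :: "'g measure \<Rightarrow> 'g set \<Rightarrow> ('g::zero \<Rightarrow> complex mat) \<Rightarrow> complex mat" where
  "indicator_coeff m B \<pi> = mat (rep_dim \<pi>) (rep_dim \<pi>)
     (\<lambda>(i, j). 1 / of_nat (rep_dim \<pi>) * (\<integral>t. indicator B t * cnj (\<pi> t $$ (j, i)) \<partial>m))"

lemma matrix_coefficient_integrable:
  fixes m :: "'g::{topological_group_add,t2_space} measure"
  assumes m: "normalized_haar_measure m" and \<pi>: "unitary_rep \<pi>"
    and B: "B \<in> sets borel" and ij: "i < rep_dim \<pi>" "j < rep_dim \<pi>"
  shows "integrable m (\<lambda>t. indicator B t * cnj (\<pi> t $$ (i, j)))"
proof (rule haar_integrable_bounded[OF m])
  have [measurable]: "(\<lambda>t. \<pi> t $$ (i, j)) \<in> borel_measurable borel"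
    using unitary_repD(4)[OF \<pi> ij] by (rule borel_measurable_continuous_onI)
  show "(\<lambda>t. indicator B t * cnj (\<pi> t $$ (i, j))) \<in> borel_measurable borel"
    using B by measurable
  show "cmod (indicator B t * cnj (\<pi> t $$ (i, j))) \<le> 1" for t
    using unitary_mat_entry_le_1[OF unitary_repD(1)[OF \<pi>] ij, of t]
    by (simp add: norm_mult indicator_def)
qed

lemma integral_double_sum:
  fixes f :: "'i \<Rightarrow> 'j \<Rightarrow> 'a \<Rightarrow> complex"
  assumes f: "\<And>i j. i \<in> I \<Longrightarrow> j \<in> J \<Longrightarrow> integrable M (f i j)"
  shows "(\<integral>t. (\<Sum>i\<in>I. \<Sum>j\<in>J. c i j * f i j t) \<partial>M) = (\<Sum>i\<in>I. \<Sum>j\<in>J. c i j * (\<integral>t. f i j t \<partial>M))"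
proof -
  have cf: "integrable M (\<lambda>t. c i j * f i j t)" if "i \<in> I" "j \<in> J" for i j
    using f[OF that] by (intro integrable_mult_right) simp
  have "(\<integral>t. (\<Sum>i\<in>I. \<Sum>j\<in>J. c i j * f i j t) \<partial>M) = (\<Sum>i\<in>I. \<integral>t. (\<Sum>j\<in>J. c i j * f i j t) \<partial>M)"
    using cf by (intro Bochner_Integration.integral_sum Bochner_Integration.integrable_sum)
  also have "\<dots> = (\<Sum>i\<in>I. \<Sum>j\<in>J. \<integral>t. c i j * f i j t \<partial>M)"
    using cf by (intro sum.cong refl Bochner_Integration.integral_sum)
  finally show ?thesis by simp
qed

text \<open>
  If \<open>A v\<close> is large, let \<open>u\<close> be the unit vector in its direction. The number \<open>\<langle>A v, u\<rangle>\<close> is the inner product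
  of the indicator function with the function \<open>t \<mapsto> \<langle>\<pi>(t) u, v\<rangle>\<close>, divided by \<open>d\<close>, and this function is
  bounded by 1 by the Cauchy-Schwarz inequality.
\<close>

lemma large_coeff_witness:
  fixes m :: "'g::{topological_group_add,t2_space} measure"
  assumes m: "normalized_haar_measure m" and \<pi>: "irreducible_unitary_rep \<pi>"
    and B: "B \<in> sets borel" and \<epsilon>: "0 < \<epsilon>"
    and large: "\<not> mat_op_norm (indicator_coeff m B \<pi>) < \<epsilon>"
  obtains a where
    "\<And>t. cmod (\<Sum>p\<in>{..<rep_dim \<pi>} \<times> {..<rep_dim \<pi>}. a p * \<pi> t $$ p) \<le> 1"
    "\<epsilon> / 2 \<le> cmod (\<integral>t. indicator B t * cnj (\<Sum>p\<in>{..<rep_dim \<pi>} \<times> {..<rep_dim \<pi>}. a p * \<pi> t $$ p) \<partial>m)"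
proof -
  define d where "d = rep_dim \<pi>"
  have u\<pi>: "unitary_rep \<pi>" and d: "0 < d" using \<pi> by (auto simp: irreducible_unitary_rep_def d_def)
  let ?A = "indicator_coeff m B \<pi>"
  have "\<exists>v. v \<in> carrier_vec d \<and> cvec_norm v \<le> 1 \<and> \<epsilon> / 2 < cvec_norm (?A *\<^sub>v v)"
  proof (rule ccontr)
    assume "\<not> ?thesis"
    then have "mat_op_norm ?A \<le> \<epsilon> / 2"
      by (intro mat_op_norm_le) (auto simp: indicator_coeff_def d_def not_less)
    then show False using large \<epsilon> by linarith
  qed
  then obtain v where v: "v \<in> carrier_vec d" "cvec_norm v \<le> 1" "\<epsilon> / 2 < cvec_norm (?A *\<^sub>v v)"
    by blast
  define n where "n = cvec_norm (?A *\<^sub>v v)"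
  have n: "\<epsilon> / 2 < n" "0 < n" using v(3) \<epsilon> by (auto simp: n_def)
  define w where "w i = vec_index (?A *\<^sub>v v) i" for i
  define u where "u i = w i / of_real n" for i
  let ?v = "vec_index v"
  define I where "I t j i = indicator B t * cnj (\<pi> t $$ (j, i))" for t j i
  have w: "w i = (\<Sum>j<d. 1 / of_nat d * (\<integral>t. I t j i \<partial>m) * ?v j)" if "i < d" for i
    using index_mat_mult_vec[OF v(1) that] by (simp add: w_def indicator_coeff_def d_def I_def del: index_mult_mat_vec)
  have sum_w: "(\<Sum>i<d. (cmod (w i))\<^sup>2) = n\<^sup>2"
    unfolding n_def cvec_norm_square w_def by (simp add: indicator_coeff_def d_def)
  have sum_u: "(\<Sum>i<d. (cmod (u i))\<^sup>2) = 1"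
    using sum_w n by (simp add: u_def norm_divide power_divide sum_divide_distrib[symmetric])
  have sum_v: "(\<Sum>j<d. (cmod (?v j))\<^sup>2) \<le> 1"
    using power_le_one[OF cvec_norm_nonneg v(2), of 2] v(1) by (simp add: cvec_norm_square)
  define a where "a = (\<lambda>(j, i). u i * cnj (?v j))"
  define g where "g t = (\<Sum>p\<in>{..<d} \<times> {..<d}. a p * \<pi> t $$ p)" for t
  have cg: "cnj (g t) = (\<Sum>i<d. cnj (u i) * (\<Sum>j<d. cnj (\<pi> t $$ (j, i)) * ?v j))" for t
  proof -
    have "g t = (\<Sum>j<d. \<Sum>i<d. u i * cnj (?v j) * \<pi> t $$ (j, i))"
      by (simp add: g_def a_def sum.cartesian_product split_def)
    also have "\<dots> = (\<Sum>i<d. \<Sum>j<d. u i * cnj (?v j) * \<pi> t $$ (j, i))" by (rule sum.swap)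
    finally show ?thesis by (simp add: sum_distrib_left mult_ac)
  qed
  have "cmod (g t) \<le> 1" for t
  proof -
    have U: "unitary_mat d (\<pi> t)" unfolding d_def by (rule unitary_repD(1)[OF u\<pi>])
    let ?x = "\<lambda>i. \<Sum>j<d. cnj (\<pi> t $$ (j, i)) * ?v j"
    have "cmod (g t) = cmod (cnj (g t))" by simp
    also have "\<dots> \<le> (\<Sum>i<d. cmod (cnj (u i) * ?x i))" unfolding cg by (rule norm_sum)
    also have "\<dots> = (\<Sum>i<d. \<bar>cmod (u i)\<bar> * \<bar>cmod (?x i)\<bar>)" by (simp add: norm_mult)
    also have "\<dots> \<le> L2_set (\<lambda>i. cmod (u i)) {..<d} * L2_set (\<lambda>i. cmod (?x i)) {..<d}"
      by (rule L2_set_mult_ineq)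
    also have "\<dots> = 1 * sqrt (\<Sum>j<d. (cmod (?v j))\<^sup>2)"
      unfolding L2_set_def sum_u unitary_adjoint_isometry[OF U] by simp
    also have "\<dots> \<le> 1" using sum_v by simp
    finally show ?thesis .
  qed
  moreover have "\<epsilon> / 2 \<le> cmod (\<integral>t. indicator B t * cnj (g t) \<partial>m)"
  proof -
    have int: "integrable m (\<lambda>t. I t j i)" if "i < d" "j < d" for i j
      unfolding I_def using matrix_coefficient_integrable[OF m u\<pi> B] that by (simp add: d_def)
    have "(\<integral>t. indicator B t * cnj (g t) \<partial>m) = (\<integral>t. (\<Sum>i<d. \<Sum>j<d. (cnj (u i) * ?v j) * I t j i) \<partial>m)"
      unfolding cg I_def by (simp add: sum_distrib_left mult_ac)
    also have "\<dots> = (\<Sum>i<d. \<Sum>j<d. (cnj (u i) * ?v j) * (\<integral>t. I t j i \<partial>m))"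
      using int by (intro integral_double_sum) auto
    also have "\<dots> = (\<Sum>i<d. cnj (u i) * (of_nat d * w i))"
      using d by (intro sum.cong refl) (simp add: w sum_distrib_left mult_ac)
    also have "\<dots> = of_nat d / of_real n * (\<Sum>i<d. w i * cnj (w i))"
      by (simp add: u_def sum_distrib_left mult_ac)
    also have "(\<Sum>i<d. w i * cnj (w i)) = of_real (n\<^sup>2)"
      by (simp only: sum_w[symmetric] of_real_sum complex_norm_square)
    also have "of_nat d / of_real n * of_real (n\<^sup>2) = complex_of_real (real d * n)"
      using n by (simp add: power2_eq_square)
    finally have "cmod (\<integral>t. indicator B t * cnj (g t) \<partial>m) = real d * n"
      using n by (simp only: norm_of_real) simp
    moreover have "1 * n \<le> real d * n" using d n by (intro mult_right_mono) auto
    ultimately show ?thesis using n by linarith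
  qed
  ultimately show ?thesis using that[of a] unfolding g_def d_def by blast
qed

text \<open>
  The witnesses for different classes are orthogonal, so by Bessel's inequality a finite set of \<open>n\<close>
  such classes satisfies \<open>n (\<epsilon>/2)\<^sup>2 \<le> 1\<close>.
\<close>

lemma indicator_coeff_vanish:
  fixes m :: "'g::{topological_group_add,t2_space} measure"
  assumes m: "normalized_haar_measure m" and B: "B \<in> sets borel" and \<epsilon>: "0 < \<epsilon>"
    and rep: "\<forall>c\<in>unitary_dual. rep c \<in> c"
  shows "finite {c\<in>unitary_dual. \<not> mat_op_norm (indicator_coeff m B (rep c)) < \<epsilon>}" (is "finite ?S")
proof -
  have irr: "irreducible_unitary_rep (rep c)" if "c \<in> unitary_dual" for c
    using unitary_dual_irreducible that rep by blast
  let ?P = "\<lambda>c. {..<rep_dim (rep c)} \<times> {..<rep_dim (rep c)}"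
  have "\<forall>c\<in>?S. \<exists>a. (\<forall>t. cmod (\<Sum>p\<in>?P c. a p * rep c t $$ p) \<le> 1) \<and>
      \<epsilon> / 2 \<le> cmod (\<integral>t. indicator B t * cnj (\<Sum>p\<in>?P c. a p * rep c t $$ p) \<partial>m)"
  proof
    fix c assume "c \<in> ?S"
    then have c: "c \<in> unitary_dual" "\<not> mat_op_norm (indicator_coeff m B (rep c)) < \<epsilon>" by auto
    show "\<exists>a. (\<forall>t. cmod (\<Sum>p\<in>?P c. a p * rep c t $$ p) \<le> 1) \<and>
      \<epsilon> / 2 \<le> cmod (\<integral>t. indicator B t * cnj (\<Sum>p\<in>?P c. a p * rep c t $$ p) \<partial>m)"
      by (rule large_coeff_witness[OF m irr[OF c(1)] B \<epsilon> c(2)]) (intro exI conjI allI)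
  qed
  from bchoice[OF this] obtain a where "\<forall>c\<in>?S. (\<forall>t. cmod (\<Sum>p\<in>?P c. a c p * rep c t $$ p) \<le> 1) \<and>
      \<epsilon> / 2 \<le> cmod (\<integral>t. indicator B t * cnj (\<Sum>p\<in>?P c. a c p * rep c t $$ p) \<partial>m)" ..
  then have a: "\<And>c t. c \<in> ?S \<Longrightarrow> cmod (\<Sum>p\<in>?P c. a c p * rep c t $$ p) \<le> 1"
    "\<And>c. c \<in> ?S \<Longrightarrow> \<epsilon> / 2 \<le> cmod (\<integral>t. indicator B t * cnj (\<Sum>p\<in>?P c. a c p * rep c t $$ p) \<partial>m)"
    by blast+
  define g where "g c t = (\<Sum>p\<in>?P c. a c p * rep c t $$ p)" for c t
  have meas_entry: "(\<lambda>t. rep c t $$ p) \<in> borel_measurable borel" if "c \<in> ?S" "p \<in> ?P c" for c p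
  proof -
    have "unitary_rep (rep c)" using irr that by (auto simp: irreducible_unitary_rep_def)
    then show ?thesis
      using unitary_repD(4)[of "rep c" "fst p" "snd p"] that by (auto intro: borel_measurable_continuous_onI)
  qed
  have meas: "g c \<in> borel_measurable borel" if "c \<in> ?S" for c
    unfolding g_def using meas_entry[OF that]
    by (intro borel_measurable_sum borel_measurable_times borel_measurable_const)
  have orth: "(\<integral>t. g c t * cnj (g c' t) \<partial>m) = 0" if c: "c \<in> ?S" "c' \<in> ?S" "c \<noteq> c'" for c c'
  proof -
    have ineq: "\<not> unitarily_equivalent (rep c) (rep c')"
      using unitary_dual_eq_if_equivalent[of c c' "rep c" "rep c'"] c rep by blast
    let ?f = "\<lambda>p q t. rep c t $$ p * cnj (rep c' t $$ q)"
    have int: "integrable m (?f p q)" if pq: "p \<in> ?P c" "q \<in> ?P c'" for p q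
    proof (rule haar_integrable_bounded[OF m])
      show "?f p q \<in> borel_measurable borel"
        using meas_entry[OF c(1) pq(1)] meas_entry[OF c(2) pq(2)] by measurable
      have "unitary_rep (rep c)" "unitary_rep (rep c')"
        using irr c by (auto simp: irreducible_unitary_rep_def)
      then show "cmod (?f p q t) \<le> 1" for t
        using unitary_mat_entry_le_1[OF unitary_repD(1), of "rep c" "fst p" "snd p" t]
          unitary_mat_entry_le_1[OF unitary_repD(1), of "rep c'" "fst q" "snd q" t] pq
        by (auto simp: norm_mult intro: mult_le_one)
    qed
    have zero: "(\<integral>t. ?f p q t \<partial>m) = 0" if "p \<in> ?P c" "q \<in> ?P c'" for p q
      using schur_orthogonality[OF m irr irr ineq, of "fst p" "snd p" "fst q" "snd q"] c that by auto
    have "(\<integral>t. g c t * cnj (g c' t) \<partial>m) =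
        (\<integral>t. (\<Sum>p\<in>?P c. \<Sum>q\<in>?P c'. (a c p * cnj (a c' q)) * ?f p q t) \<partial>m)"
      unfolding g_def by (simp add: sum_product mult_ac)
    also have "\<dots> = (\<Sum>p\<in>?P c. \<Sum>q\<in>?P c'. (a c p * cnj (a c' q)) * (\<integral>t. ?f p q t \<partial>m))"
      by (rule integral_double_sum) (rule int)
    also have "\<dots> = 0" using zero by (intro sum.neutral ballI) (simp del: mem_Sigma_iff)
    finally show ?thesis .
  qed
  have card: "card K \<le> nat \<lceil>4 / \<epsilon>\<^sup>2\<rceil>" if K: "K \<subseteq> ?S" "finite K" for K
  proof -
    have hB: "(indicator B :: 'g \<Rightarrow> complex) \<in> borel_measurable borel" using B by simp
    have "real (card K) * (\<epsilon> / 2)\<^sup>2 = (\<Sum>c\<in>K. (\<epsilon> / 2)\<^sup>2)" by simp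
    also have "\<dots> \<le> (\<Sum>c\<in>K. (cmod (\<integral>t. indicator B t * cnj (g c t) \<partial>m))\<^sup>2)"
      using a(2) K(1) \<epsilon> unfolding g_def by (intro sum_mono power_mono) auto
    also have "\<dots> \<le> (\<integral>t. (cmod (indicator B t))\<^sup>2 \<partial>m)"
    proof (rule bessel_inequality[OF m K(2), where C = 1])
      show "\<And>k t. k \<in> K \<Longrightarrow> cmod (g k t) \<le> 1" unfolding g_def using a(1) K(1) by blast
      show "\<And>t. cmod (indicator B t) \<le> 1" by (simp add: indicator_def)
    qed (use meas orth hB K(1) in auto)
    also have "\<dots> \<le> (\<integral>t. 1 \<partial>m)"
    proof -
      interpret finite_measure m by (rule haar_finite_measure(1)[OF m])
      show ?thesis by (intro integral_mono_AE') (auto simp: indicator_def)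
    qed
    also have "\<dots> = 1" using haar_finite_measure(3,4)[OF m] by simp
    finally have "real (card K) \<le> 4 / \<epsilon>\<^sup>2" using \<epsilon> by (simp add: field_simps power2_eq_square)
    then show ?thesis by linarith
  qed
  then show ?thesis using finite_if_finite_subsets_card_bdd[of ?S] by blast
qed

section \<open>Measures with a simple density\<close>

lemma additive_variation_le_restricted_haar:
  fixes m :: "'g::{topological_group_add,t2_space} measure" and x :: "'x::real_normed_vector"
  assumes m: "normalized_haar_measure m" and B: "B \<in> sets borel"
  shows "additive_variation_le (\<lambda>A. measure m (A \<inter> B) *\<^sub>R x) (norm x)"
  unfolding additive_variation_le_def
proof (intro conjI ballI allI impI)
  interpret finite_measure m by (rule haar_finite_measure(1)[OF m])
  note sets = haar_finite_measure(2)[OF m]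
  fix A C :: "'g set" assume "A \<in> sets borel" "C \<in> sets borel" "A \<inter> C = {}"
  then have "measure m ((A \<inter> B) \<union> (C \<inter> B)) = measure m (A \<inter> B) + measure m (C \<inter> B)"
    using B sets by (intro finite_measure_Union) auto
  then show "measure m ((A \<union> C) \<inter> B) *\<^sub>R x = measure m (A \<inter> B) *\<^sub>R x + measure m (C \<inter> B) *\<^sub>R x"
    by (simp add: Int_Un_distrib2 scaleR_left_distrib)
next
  interpret finite_measure m by (rule haar_finite_measure(1)[OF m])
  note sets = haar_finite_measure(2)[OF m]
  fix \<rho> :: "'g set set" assume \<rho>: "finite \<rho>" "\<rho> \<subseteq> sets borel" "partition_on UNIV \<rho>"
  have "(\<Sum>E\<in>\<rho>. measure m (E \<inter> B)) = measure m (\<Union>E\<in>\<rho>. E \<inter> B)"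
  proof (rule finite_measure_finite_Union[symmetric])
    show "disjoint_family_on (\<lambda>E. E \<inter> B) \<rho>"
      using partition_onD2[OF \<rho>(3)] by (fastforce simp: disjoint_family_on_def disjoint_def)
  qed (use \<rho> B sets in auto)
  also have "\<dots> \<le> 1" using bounded_measure haar_finite_measure(3,4)[OF m] by metis
  finally have "(\<Sum>E\<in>\<rho>. measure m (E \<inter> B)) * norm x \<le> 1 * norm x"
    by (rule mult_right_mono) simp
  then show "(\<Sum>E\<in>\<rho>. norm (measure m (E \<inter> B) *\<^sub>R x)) \<le> norm x"
    by (simp add: sum_distrib_right)
qed

text \<open>
  The scalar counterpart of \<open>vm_integral_near_sampling\<close>. The integral against the restricted Haar
  measure times a vector is approximated by the same finite sums, which identifies it below.
\<close>

lemma haar_integral_sampling: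
  fixes m :: "'g::{topological_group_add,t2_space} measure" and g :: "'g \<Rightarrow> complex"
  assumes m: "normalized_haar_measure m" and B: "B \<in> sets borel" and r: "finite_borel_labelling r"
    and g: "g \<in> borel_measurable borel" "\<And>t. cmod (g t) \<le> C" and le: "\<And>t. dist (g (r t)) (g t) \<le> e"
  shows "cmod ((\<Sum>l\<in>range r. g l * of_real (measure m (r -` {l} \<inter> B))) - (\<integral>t. indicator B t * g t \<partial>m)) \<le> e"
proof -
  interpret finite_measure m by (rule haar_finite_measure(1)[OF m])
  note sets = haar_finite_measure(2)[OF m] and space = haar_finite_measure(3)[OF m]
  have fin: "finite (range r)" and fib: "\<And>l. r -` {l} \<in> sets borel" using r by (auto simp: finite_borel_labelling_def)
  have e: "0 \<le> e" using le zero_le_dist order_trans by blast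
  have simple: "indicator B t * g (r t) = (\<Sum>l\<in>range r. g l * indicator (r -` {l} \<inter> B) t)" for t
  proof -
    have "(\<Sum>l\<in>range r. g l * indicator (r -` {l} \<inter> B) t) = (\<Sum>l\<in>range r. if l = r t then g (r t) * indicator B t else 0)"
      by (intro sum.cong) (auto simp: indicator_def)
    then show ?thesis using fin by (simp add: sum.delta)
  qed
  have ind: "integrable m (\<lambda>t. indicator (r -` {l} \<inter> B) t :: complex)" for l
    by (rule haar_integrable_bounded[OF m, where C = 1]) (use fib B in \<open>auto split: split_indicator\<close>)
  have int1: "integrable m (\<lambda>t. indicator B t * g (r t))"
    unfolding simple using ind by (intro Bochner_Integration.integrable_sum integrable_mult_right) auto
  have int2: "integrable m (\<lambda>t. indicator B t * g t)"
  proof (rule haar_integrable_bounded[OF m])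
    show "(\<lambda>t. indicator B t * g t) \<in> borel_measurable borel" using g(1) B by measurable
    show "cmod (indicator B t * g t) \<le> C" for t
      using g(2)[of t] order_trans[OF norm_ge_zero g(2)[of t]] by (simp add: norm_mult indicator_def)
  qed
  have "(\<integral>t. indicator B t * g (r t) \<partial>m) = (\<Sum>l\<in>range r. g l * of_real (measure m (r -` {l} \<inter> B)))"
  proof -
    have "(\<integral>t. (indicator A t :: complex) \<partial>m) = of_real (measure m A)" if "A \<in> sets m" for A
    proof -
      have "(\<integral>t. (indicator A t :: complex) \<partial>m) = (\<integral>t. complex_of_real (indicator A t) \<partial>m)"
        by (intro Bochner_Integration.integral_cong) (auto simp: indicator_def)
      then show ?thesis using that space by simp
    qed
    then show ?thesis
      unfolding simple using ind fib B sets by (subst Bochner_Integration.integral_sum) auto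
  qed
  then have "(\<Sum>l\<in>range r. g l * of_real (measure m (r -` {l} \<inter> B))) - (\<integral>t. indicator B t * g t \<partial>m) =
      (\<integral>t. indicator B t * g (r t) - indicator B t * g t \<partial>m)"
    using int1 int2 by simp
  also have "cmod \<dots> \<le> (\<integral>t. cmod (indicator B t * g (r t) - indicator B t * g t) \<partial>m)"
    by (rule integral_norm_bound)
  also have "\<dots> \<le> (\<integral>t. e \<partial>m)"
  proof (rule integral_mono)
    show "integrable m (\<lambda>t. cmod (indicator B t * g (r t) - indicator B t * g t))" using int1 int2 by simp
    show "cmod (indicator B t * g (r t) - indicator B t * g t) \<le> e" for t
      using le[of t] e by (simp add: indicator_def dist_norm)
  qed simp
  also have "\<dots> = e" using haar_finite_measure(3,4)[OF m] by simp
  finally show ?thesis .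
qed

context operator_space
begin

lemma vm_integral_restricted_haar:
  fixes m :: "'g::{topological_group_add,t2_space} measure" and g :: "'g \<Rightarrow> complex"
  assumes comp: "compact (UNIV :: 'g set)" and m: "normalized_haar_measure m"
    and B: "B \<in> sets borel" and g: "continuous_on UNIV g"
  shows "vm_integral smul borel (\<lambda>A. measure m (A \<inter> B) *\<^sub>R x) g = smul (\<integral>t. indicator B t * g t \<partial>m) x"
proof -
  let ?\<nu> = "\<lambda>A. measure m (A \<inter> B) *\<^sub>R x"
  let ?D = "vm_integral smul borel ?\<nu> g - smul (\<integral>t. indicator B t * g t \<partial>m) x"
  note \<nu> = additive_variation_le_restricted_haar[OF m B, of x]
  have gm: "g \<in> borel_measurable borel" using g by (rule borel_measurable_continuous_onI)
  obtain C where C: "\<And>t. cmod (g t) \<le> C"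
    using compact_imp_bounded[OF compact_continuous_image[OF g comp]] by (auto simp: bounded_iff)
  have "norm ?D \<le> 0"
  proof (rule field_le_epsilon)
    fix e :: real assume e: "0 < e"
    define \<delta> where "\<delta> = e / (2 * norm x + 1)"
    have p: "0 < 2 * norm x + 1" by (simp add: add_nonneg_pos)
    have \<delta>: "0 < \<delta>" "2 * \<delta> * norm x \<le> e"
    proof -
      show "0 < \<delta>" using e p by (simp add: \<delta>_def)
      then have "\<delta> * (2 * norm x) \<le> \<delta> * (2 * norm x + 1)" by (intro mult_left_mono) auto
      also have "\<dots> = e" using p by (simp add: \<delta>_def)
      finally show "2 * \<delta> * norm x \<le> e" by (simp add: mult_ac)
    qed
    obtain r :: "'g \<Rightarrow> 'g" where r: "finite_borel_labelling r" "\<And>t. dist (g (r t)) (g t) < \<delta>"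
      using sampling_labelling_exists[OF comp, of "{()}" "\<lambda>_. g" \<delta>] g \<delta> by auto
    let ?c = "\<Sum>l\<in>range r. g l * of_real (measure m (r -` {l} \<inter> B))"
    have S: "(\<Sum>l\<in>range r. smul (g l) (?\<nu> (r -` {l}))) = smul ?c x"
      by (simp add: scale_sum_left smul_of_real[symmetric])
    have 1: "norm (vm_integral smul borel ?\<nu> g - smul ?c x) \<le> \<delta> * norm x"
      using vm_integral_near_sampling[OF comp \<nu> g r] unfolding S .
    have "cmod (?c - (\<integral>t. indicator B t * g t \<partial>m)) \<le> \<delta>"
      using haar_integral_sampling[OF m B r(1) gm C less_imp_le[OF r(2)]] .
    then have 2: "norm (smul ?c x - smul (\<integral>t. indicator B t * g t \<partial>m) x) \<le> \<delta> * norm x"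
      by (simp add: scale_left_diff_distrib[symmetric] norm_smul mult_right_mono)
    have "?D = (vm_integral smul borel ?\<nu> g - smul ?c x) + (smul ?c x - smul (\<integral>t. indicator B t * g t \<partial>m) x)"
      by simp
    also have "norm \<dots> \<le> \<delta> * norm x + \<delta> * norm x" using 1 2 by (rule norm_triangle_mono)
    finally show "norm ?D \<le> 0 + e" using \<delta>(2) by simp
  qed
  then show ?thesis by simp
qed

lemma fourier_coeff_restricted_haar:
  fixes m :: "'g::{topological_group_add,t2_space} measure"
  assumes comp: "compact (UNIV :: 'g set)" and m: "normalized_haar_measure m"
    and B: "B \<in> sets borel" and \<pi>: "unitary_rep \<pi>"
  shows "fourier_coeff smul (\<lambda>A. measure m (A \<inter> B) *\<^sub>R x) \<pi> = scalar_tensor (indicator_coeff m B \<pi>) x"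
proof (rule eq_matI)
  fix i j assume "i < dim_row (scalar_tensor (indicator_coeff m B \<pi>) x)"
    "j < dim_col (scalar_tensor (indicator_coeff m B \<pi>) x)"
  then have ij: "i < rep_dim \<pi>" "j < rep_dim \<pi>" by (auto simp: scalar_tensor_def indicator_coeff_def)
  have "continuous_on UNIV (\<lambda>t. cnj (\<pi> t $$ (j, i)))"
    using unitary_repD(4)[OF \<pi> ij(2,1)] by (rule continuous_on_cnj)
  from vm_integral_restricted_haar[OF comp m B this, of x]
  show "fourier_coeff smul (\<lambda>A. measure m (A \<inter> B) *\<^sub>R x) \<pi> $$ (i, j) =
      scalar_tensor (indicator_coeff m B \<pi>) x $$ (i, j)"
    using ij by (simp add: fourier_coeff_def scalar_tensor_def indicator_coeff_def)
qed (auto simp: fourier_coeff_def scalar_tensor_def indicator_coeff_def)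

definition coeffs_vanish ::
    "(('g::topological_group_add \<Rightarrow> complex mat) set \<Rightarrow> 'g \<Rightarrow> complex mat) \<Rightarrow> ('g set \<Rightarrow> 'x) \<Rightarrow> bool" where
  "coeffs_vanish rep \<nu> \<longleftrightarrow>
     (\<forall>\<epsilon>>0. finite {c\<in>unitary_dual. \<not> mnorm (fourier_coeff smul \<nu> (rep c)) < \<epsilon>})"

lemma coeffs_vanish_restricted_haar:
  fixes m :: "'g::{topological_group_add,t2_space} measure"
  assumes comp: "compact (UNIV :: 'g set)" and m: "normalized_haar_measure m"
    and B: "B \<in> sets borel" and rep: "\<forall>c\<in>unitary_dual. rep c \<in> c"
  shows "coeffs_vanish rep (\<lambda>A. measure m (A \<inter> B) *\<^sub>R x)"
  unfolding coeffs_vanish_def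
proof (intro allI impI)
  fix \<epsilon> :: real assume \<epsilon>: "0 < \<epsilon>"
  define \<delta> where "\<delta> = \<epsilon> / (norm x + 1)"
  have p: "0 < norm x + 1" by (simp add: add_nonneg_pos)
  have \<delta>: "0 < \<delta>" using \<epsilon> p by (simp add: \<delta>_def)
  have "\<delta> * norm x < \<delta> * (norm x + 1)" using \<delta> by simp
  also have "\<dots> = \<epsilon>" using p by (simp add: \<delta>_def)
  finally have \<delta>x: "\<delta> * norm x < \<epsilon>" .
  have "mnorm (fourier_coeff smul (\<lambda>A. measure m (A \<inter> B) *\<^sub>R x) (rep c)) < \<epsilon>"
    if c: "c \<in> unitary_dual" and small: "mat_op_norm (indicator_coeff m B (rep c)) < \<delta>" for c
  proof -
    have u: "unitary_rep (rep c)"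
      using unitary_dual_irreducible c rep by (auto simp: irreducible_unitary_rep_def)
    have "mnorm (scalar_tensor (indicator_coeff m B (rep c)) x) \<le> \<delta> * norm x"
      by (rule mnorm_tensor_le[where d = "rep_dim (rep c)"]) (use small \<delta> in \<open>auto simp: indicator_coeff_def\<close>)
    then show ?thesis using \<delta>x by (simp add: fourier_coeff_restricted_haar[OF comp m B u])
  qed
  then have "{c\<in>unitary_dual. \<not> mnorm (fourier_coeff smul (\<lambda>A. measure m (A \<inter> B) *\<^sub>R x) (rep c)) < \<epsilon>}
      \<subseteq> {c\<in>unitary_dual. \<not> mat_op_norm (indicator_coeff m B (rep c)) < \<delta>}" by blast
  then show "finite {c\<in>unitary_dual. \<not> mnorm (fourier_coeff smul (\<lambda>A. measure m (A \<inter> B) *\<^sub>R x) (rep c)) < \<epsilon>}"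
    using indicator_coeff_vanish[OF m B \<delta> rep] by (rule finite_subset)
qed

lemma mnorm_fourier_coeff_add_le:
  fixes \<nu> :: "'g::topological_group_add set \<Rightarrow> 'x"
  assumes comp: "compact (UNIV :: 'g set)" and \<nu>: "additive_variation_le \<nu> V"
    and \<mu>: "additive_variation_le \<mu> W" and \<pi>: "unitary_rep \<pi>"
  shows "mnorm (fourier_coeff smul (\<lambda>A. \<nu> A + \<mu> A) \<pi>) \<le>
    mnorm (fourier_coeff smul \<nu> \<pi>) + mnorm (fourier_coeff smul \<mu> \<pi>)"
  unfolding fourier_coeff_add_measure[OF assms]
  by (rule mnorm_triangle[where n = "rep_dim \<pi>"]) (auto simp: fourier_coeff_def)

lemma coeffs_vanish_add:
  fixes \<nu> :: "'g::topological_group_add set \<Rightarrow> 'x"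
  assumes comp: "compact (UNIV :: 'g set)" and rep: "\<forall>c\<in>unitary_dual. rep c \<in> c"
    and \<nu>: "additive_variation_le \<nu> V" "coeffs_vanish rep \<nu>"
    and \<mu>: "additive_variation_le \<mu> W" "coeffs_vanish rep \<mu>"
  shows "coeffs_vanish rep (\<lambda>A. \<nu> A + \<mu> A)"
  unfolding coeffs_vanish_def
proof (intro allI impI)
  fix \<epsilon> :: real assume \<epsilon>: "0 < \<epsilon>"
  let ?S = "\<lambda>\<nu> \<epsilon>. {c\<in>unitary_dual. \<not> mnorm (fourier_coeff smul \<nu> (rep c)) < \<epsilon>}"
  have "c \<in> ?S \<nu> (\<epsilon> / 2) \<union> ?S \<mu> (\<epsilon> / 2)" if c: "c \<in> ?S (\<lambda>A. \<nu> A + \<mu> A) \<epsilon>" for c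
  proof -
    have "unitary_rep (rep c)"
      using unitary_dual_irreducible c rep by (auto simp: irreducible_unitary_rep_def)
    from mnorm_fourier_coeff_add_le[OF comp \<nu>(1) \<mu>(1) this] show ?thesis using c by auto
  qed
  then have "?S (\<lambda>A. \<nu> A + \<mu> A) \<epsilon> \<subseteq> ?S \<nu> (\<epsilon> / 2) \<union> ?S \<mu> (\<epsilon> / 2)" by blast
  moreover have "finite (?S \<nu> (\<epsilon> / 2) \<union> ?S \<mu> (\<epsilon> / 2))"
    using \<nu>(2) \<mu>(2) half_gt_zero[OF \<epsilon>] unfolding coeffs_vanish_def by blast
  ultimately show "finite (?S (\<lambda>A. \<nu> A + \<mu> A) \<epsilon>)" by (rule finite_subset)
qed

text \<open>
  The uniform bound \<open>mnorm_fourier_coeff_le\<close> makes the coefficients of \<open>\<nu>\<close> and \<open>\<mu>\<close> differ by at most the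
  variation of \<open>\<nu> - \<mu>\<close>, for all representations at once.
\<close>

lemma coeffs_vanish_limit:
  fixes \<nu> :: "'g::topological_group_add set \<Rightarrow> 'x"
  assumes comp: "compact (UNIV :: 'g set)" and rep: "\<forall>c\<in>unitary_dual. rep c \<in> c"
    and approx: "\<And>e. 0 < e \<Longrightarrow> \<exists>\<mu> W. additive_variation_le \<mu> W \<and> coeffs_vanish rep \<mu> \<and>
      additive_variation_le (\<lambda>A. \<nu> A - \<mu> A) e"
  shows "coeffs_vanish rep \<nu>"
  unfolding coeffs_vanish_def
proof (intro allI impI)
  fix \<epsilon> :: real assume \<epsilon>: "0 < \<epsilon>"
  let ?S = "\<lambda>\<nu> \<epsilon>. {c\<in>unitary_dual. \<not> mnorm (fourier_coeff smul \<nu> (rep c)) < \<epsilon>}"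
  obtain \<mu> W where \<mu>: "additive_variation_le \<mu> W" "coeffs_vanish rep \<mu>"
    and diff: "additive_variation_le (\<lambda>A. \<nu> A - \<mu> A) (\<epsilon> / 2)"
    using approx[of "\<epsilon> / 2"] \<epsilon> by auto
  have "c \<in> ?S \<mu> (\<epsilon> / 2)" if c: "c \<in> ?S \<nu> \<epsilon>" for c
  proof -
    have u: "unitary_rep (rep c)" and d: "0 < rep_dim (rep c)"
      using unitary_dual_irreducible c rep by (auto simp: irreducible_unitary_rep_def)
    from mnorm_fourier_coeff_add_le[OF comp \<mu>(1) diff u] mnorm_fourier_coeff_le[OF comp diff u d]
    show ?thesis using c by auto
  qed
  then have "?S \<nu> \<epsilon> \<subseteq> ?S \<mu> (\<epsilon> / 2)" by blast
  moreover have "finite (?S \<mu> (\<epsilon> / 2))" using \<mu>(2) half_gt_zero[OF \<epsilon>] unfolding coeffs_vanish_def by blast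
  ultimately show "finite (?S \<nu> \<epsilon>)" by (rule finite_subset)
qed

lemma coeffs_vanish_simple_density:
  fixes m :: "'g::{topological_group_add,t2_space} measure"
  assumes comp: "compact (UNIV :: 'g set)" and m: "normalized_haar_measure m"
    and rep: "\<forall>c\<in>unitary_dual. rep c \<in> c"
    and S: "finite S" "\<And>x. x \<in> S \<Longrightarrow> B x \<in> sets borel"
  shows "additive_variation_le (\<lambda>A. \<Sum>x\<in>S. measure m (A \<inter> B x) *\<^sub>R x) (\<Sum>x\<in>S. norm x) \<and>
    coeffs_vanish rep (\<lambda>A. \<Sum>x\<in>S. measure m (A \<inter> B x) *\<^sub>R x)"
  using S
proof (induction S)
  case empty
  have "additive_variation_le (\<lambda>A. measure m (A \<inter> {}) *\<^sub>R (0::'x)) (norm (0::'x))"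
    by (rule additive_variation_le_restricted_haar[OF m]) simp
  moreover have "coeffs_vanish rep (\<lambda>A. measure m (A \<inter> {}) *\<^sub>R 0)"
    by (rule coeffs_vanish_restricted_haar[OF comp m _ rep]) simp
  ultimately show ?case by simp
next
  case (insert x S)
  then have IH: "additive_variation_le (\<lambda>A. \<Sum>x\<in>S. measure m (A \<inter> B x) *\<^sub>R x) (\<Sum>x\<in>S. norm x)"
    "coeffs_vanish rep (\<lambda>A. \<Sum>x\<in>S. measure m (A \<inter> B x) *\<^sub>R x)" by auto
  have Bx: "B x \<in> sets borel" using insert.prems by simp
  note x = additive_variation_le_restricted_haar[OF m Bx] coeffs_vanish_restricted_haar[OF comp m Bx rep]
  show ?case
    using additive_variation_le_add[OF x(1)[of x] IH(1)] coeffs_vanish_add[OF comp rep x(1)[of x] x(2)[of x] IH]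
      insert.hyps by simp
qed

end

section \<open>Bochner densities\<close>

text \<open>
  Subtraction need not be Borel measurable in a nonseparable space. Here one of the functions takes
  finitely many values, so the difference is glued from finitely many measurable pieces.
\<close>

lemma borel_measurable_norm_diff_simple:
  fixes f :: "'g \<Rightarrow> 'x::real_normed_vector"
  assumes f: "f \<in> borel_measurable M" and s: "simple_function M s"
  shows "(\<lambda>t. norm (f t - s t)) \<in> borel_measurable M"
proof (rule measurable_compose_countable'[where f = "\<lambda>x t. norm (f t - x)" and g = s and I = "s ` space M"])
  fix x :: 'x
  have "(\<lambda>y. norm (y - x)) \<in> borel_measurable borel"
    by (intro borel_measurable_continuous_onI continuous_intros)
  then show "(\<lambda>t. norm (f t - x)) \<in> borel_measurable M" by (rule measurable_compose[OF f])
next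
  show "s \<in> measurable M (count_space (s ` space M))" using measurable_simple_function[OF s]
    by (auto simp: measurable_count_space_eq2 simple_functionD(1)[OF s] intro: simple_functionD(2)[OF s])
  show "countable (s ` space M)" using simple_functionD(1)[OF s] by (rule countable_finite)
qed

text \<open>
  The triangle inequality for the approximating simple functions, passed to the limit; it takes the
  place of a norm estimate for the Bochner integral of \<open>f - s\<close>.
\<close>

lemma bochner_integral_near_simple:
  fixes f :: "'g \<Rightarrow> 'x::banach"
  assumes f: "bochner_integral_is M f x" and s: "Bochner_Integration.simple_bochner_integrable M s"
  shows "ennreal (norm (x - Bochner_Integration.simple_bochner_integral M s)) \<le>
    (\<integral>\<^sup>+t. ennreal (norm (f t - s t)) \<partial>M)"
proof -
  let ?I = "Bochner_Integration.simple_bochner_integral M"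
  obtain u where fm: "f \<in> borel_measurable M"
    and u: "\<And>n. Bochner_Integration.simple_bochner_integrable M (u n)"
    and u0: "(\<lambda>n. \<integral>\<^sup>+t. ennreal (norm (f t - u n t)) \<partial>M) \<longlonglongrightarrow> 0"
    and ux: "(\<lambda>n. ?I (u n)) \<longlonglongrightarrow> x"
    using f by (auto simp: bochner_integral_is_def)
  have ms: "(\<lambda>t. norm (f t - w t)) \<in> borel_measurable M"
    if "Bochner_Integration.simple_bochner_integrable M w" for w
    using that borel_measurable_norm_diff_simple[OF fm]
    by (auto elim: Bochner_Integration.simple_bochner_integrable.cases)
  have "ennreal (norm (?I (u n) - ?I s)) \<le>
      (\<integral>\<^sup>+t. ennreal (norm (f t - u n t)) \<partial>M) + (\<integral>\<^sup>+t. ennreal (norm (f t - s t)) \<partial>M)" for n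
  proof -
    have d: "Bochner_Integration.simple_bochner_integrable M (\<lambda>t. u n t - s t)"
      "Bochner_Integration.simple_bochner_integrable M (\<lambda>t. norm (u n t - s t))"
      using simple_bochner_integrable_compose2[of "(-)" M "u n" s]
        simple_bochner_integrable_compose2[of "\<lambda>x y. norm (x - y)" M "u n" s] u s by auto
    have "norm (?I (u n) - ?I s) = norm (?I (\<lambda>t. u n t - s t))"
      using u s by (simp add: simple_bochner_integral_diff)
    also have "\<dots> \<le> Bochner_Integration.simple_bochner_integral M (\<lambda>t. norm (u n t - s t))"
      by (rule simple_bochner_integral_norm_bound[OF d(1)])
    finally have "ennreal (norm (?I (u n) - ?I s)) \<le>
        ennreal (Bochner_Integration.simple_bochner_integral M (\<lambda>t. norm (u n t - s t)))"
      by (rule ennreal_leI)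
    also have "\<dots> = (\<integral>\<^sup>+t. ennreal (norm (u n t - s t)) \<partial>M)"
      by (rule simple_bochner_integral_eq_nn_integral[OF d(2)]) simp
    also have "\<dots> \<le> (\<integral>\<^sup>+t. ennreal (norm (f t - u n t)) + ennreal (norm (f t - s t)) \<partial>M)"
    proof (rule nn_integral_mono)
      fix t
      have "norm (u n t - s t) \<le> norm (f t - u n t) + norm (f t - s t)"
        using norm_triangle_ineq4[of "f t - s t" "f t - u n t"] by simp
      then show "ennreal (norm (u n t - s t)) \<le> ennreal (norm (f t - u n t)) + ennreal (norm (f t - s t))"
        by (simp flip: ennreal_plus)
    qed
    also have "\<dots> = (\<integral>\<^sup>+t. ennreal (norm (f t - u n t)) \<partial>M) + (\<integral>\<^sup>+t. ennreal (norm (f t - s t)) \<partial>M)"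
      using ms[OF u] ms[OF s] by (intro nn_integral_add) auto
    finally show ?thesis .
  qed
  moreover have "(\<lambda>n. ennreal (norm (?I (u n) - ?I s))) \<longlonglongrightarrow> ennreal (norm (x - ?I s))"
    by (intro tendsto_ennrealI tendsto_intros ux)
  moreover have "(\<lambda>n. (\<integral>\<^sup>+t. ennreal (norm (f t - u n t)) \<partial>M) + (\<integral>\<^sup>+t. ennreal (norm (f t - s t)) \<partial>M))
      \<longlonglongrightarrow> 0 + (\<integral>\<^sup>+t. ennreal (norm (f t - s t)) \<partial>M)"
    by (intro tendsto_add u0 tendsto_const)
  ultimately show ?thesis
    using LIMSEQ_le[of _ "ennreal (norm (x - ?I s))"] by fastforce
qed

lemma simple_bochner_integral_indicator:
  fixes s :: "'g \<Rightarrow> 'x::real_normed_vector"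
  assumes s: "finite (range s)" and space: "space M = UNIV"
  shows "Bochner_Integration.simple_bochner_integral M (\<lambda>t. indicator A t *\<^sub>R s t) =
    (\<Sum>x\<in>range s. measure M (A \<inter> s -` {x}) *\<^sub>R x)"
proof -
  let ?h = "\<lambda>t. indicator A t *\<^sub>R s t"
  have ran: "range ?h - {0} \<subseteq> range s - {0}" by (auto simp: indicator_def)
  then have fin: "finite (range ?h)" using s by (metis finite_Diff finite_subset finite.emptyI finite_insert finite_Diff2)
  have fib: "{t. ?h t = x} = A \<inter> s -` {x}" if "x \<noteq> 0" for x using that by (auto simp: indicator_def)
  have "Bochner_Integration.simple_bochner_integral M ?h = (\<Sum>x\<in>range ?h. measure M {t. ?h t = x} *\<^sub>R x)"
    by (simp add: simple_bochner_integral_def space)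
  also have "\<dots> = (\<Sum>x\<in>range ?h - {0}. measure M {t. ?h t = x} *\<^sub>R x)"
    using fin by (intro sum.mono_neutral_right) auto
  also have "\<dots> = (\<Sum>x\<in>range s - {0}. measure M {t. ?h t = x} *\<^sub>R x)"
  proof (rule sum.mono_neutral_left[OF _ ran])
    show "\<forall>x\<in>(range s - {0}) - (range ?h - {0}). measure M {t. ?h t = x} *\<^sub>R x = 0"
    proof
      fix x assume "x \<in> (range s - {0}) - (range ?h - {0})"
      then have "x \<notin> range ?h" by blast
      then have "{t. ?h t = x} = {}" by blast
      then show "measure M {t. ?h t = x} *\<^sub>R x = 0" by simp
    qed
  qed (use s in simp)
  also have "\<dots> = (\<Sum>x\<in>range s - {0}. measure M (A \<inter> s -` {x}) *\<^sub>R x)"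
    by (intro sum.cong) (auto simp: fib)
  also have "\<dots> = (\<Sum>x\<in>range s. measure M (A \<inter> s -` {x}) *\<^sub>R x)"
    using s by (intro sum.mono_neutral_left) auto
  finally show ?thesis .
qed

text \<open>
  On each cell of a partition the difference is bounded by the integral of \<open>\<parallel>f - s\<parallel>\<close> over the cell, and
  the cells add up to the whole space.
\<close>

lemma additive_variation_le_density_diff:
  fixes m :: "'g::topological_space measure" and f :: "'g \<Rightarrow> 'x::banach"
  assumes sets: "sets m = sets borel" and f: "f \<in> borel_measurable m"
    and dens: "\<And>A. A \<in> sets borel \<Longrightarrow> bochner_integral_is m (\<lambda>t. indicator A t *\<^sub>R f t) (\<nu> A)"
    and s: "Bochner_Integration.simple_bochner_integrable m s"
    and \<nu>: "additive_variation_le \<nu> V"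
    and \<mu>: "additive_variation_le (\<lambda>A. \<Sum>x\<in>range s. measure m (A \<inter> s -` {x}) *\<^sub>R x) W"
    and close: "(\<integral>\<^sup>+t. ennreal (norm (f t - s t)) \<partial>m) \<le> ennreal e" and e: "0 \<le> e"
  shows "additive_variation_le (\<lambda>A. \<nu> A - (\<Sum>x\<in>range s. measure m (A \<inter> s -` {x}) *\<^sub>R x)) e"
  unfolding additive_variation_le_def
proof (intro conjI ballI allI impI)
  fix A B :: "'g set" assume "A \<in> sets borel" "B \<in> sets borel" "A \<inter> B = {}"
  then show "\<nu> (A \<union> B) - (\<Sum>x\<in>range s. measure m ((A \<union> B) \<inter> s -` {x}) *\<^sub>R x) =
      \<nu> A - (\<Sum>x\<in>range s. measure m (A \<inter> s -` {x}) *\<^sub>R x) + (\<nu> B - (\<Sum>x\<in>range s. measure m (B \<inter> s -` {x}) *\<^sub>R x))"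
    using \<nu> \<mu> by (simp add: additive_variation_le_def)
next
  have space: "space m = UNIV" using sets_eq_imp_space_eq[OF sets] by simp
  have sf: "simple_function m s" using s by (auto elim: Bochner_Integration.simple_bochner_integrable.cases)
  let ?h = "\<lambda>t. ennreal (norm (f t - s t))"
  have hm: "?h \<in> borel_measurable m" using borel_measurable_norm_diff_simple[OF f sf] by measurable
  have near: "ennreal (norm (\<nu> A - (\<Sum>x\<in>range s. measure m (A \<inter> s -` {x}) *\<^sub>R x))) \<le> (\<integral>\<^sup>+t. indicator A t * ?h t \<partial>m)"
    if A: "A \<in> sets borel" for A
  proof -
    have "Bochner_Integration.simple_bochner_integrable m (\<lambda>t. indicator A t *\<^sub>R s t)"
    proof (rule Bochner_Integration.simple_bochner_integrable.intros)
      have "simple_function m (indicator A :: 'g \<Rightarrow> real)" using A sets by (intro simple_function_indicator) simp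
      then show "simple_function m (\<lambda>t. indicator A t *\<^sub>R s t)" using sf by (rule simple_function_compose2)
      have "s -` {0} \<inter> space m \<in> sets m" using sf by (rule simple_functionD(2))
      moreover have "{y \<in> space m. s y \<noteq> 0} = space m - (s -` {0} \<inter> space m)" by auto
      ultimately have "emeasure m {y \<in> space m. indicator A y *\<^sub>R s y \<noteq> 0} \<le> emeasure m {y \<in> space m. s y \<noteq> 0}"
        by (intro emeasure_mono) auto
      moreover have "emeasure m {y \<in> space m. s y \<noteq> 0} \<noteq> \<infinity>"
        using s by (auto elim: Bochner_Integration.simple_bochner_integrable.cases)
      ultimately show "emeasure m {y \<in> space m. indicator A y *\<^sub>R s y \<noteq> 0} \<noteq> \<infinity>"
        by (auto simp: top_unique)
    qed
    from bochner_integral_near_simple[OF dens[OF A] this]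
    have "ennreal (norm (\<nu> A - (\<Sum>x\<in>range s. measure m (A \<inter> s -` {x}) *\<^sub>R x))) \<le>
        (\<integral>\<^sup>+t. ennreal (norm (indicator A t *\<^sub>R f t - indicator A t *\<^sub>R s t)) \<partial>m)"
      using simple_bochner_integral_indicator[OF _ space, of s A] simple_functionD(1)[OF sf] space by simp
    also have "\<dots> = (\<integral>\<^sup>+t. indicator A t * ?h t \<partial>m)"
      by (intro nn_integral_cong) (auto simp: indicator_def)
    finally show ?thesis .
  qed
  fix \<rho> :: "'g set set" assume \<rho>: "finite \<rho>" "\<rho> \<subseteq> sets borel" "partition_on UNIV \<rho>"
  let ?d = "\<lambda>E. norm (\<nu> E - (\<Sum>x\<in>range s. measure m (E \<inter> s -` {x}) *\<^sub>R x))"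
  have "ennreal (\<Sum>E\<in>\<rho>. ?d E) = (\<Sum>E\<in>\<rho>. ennreal (?d E))" by (simp add: sum_ennreal)
  also have "\<dots> \<le> (\<Sum>E\<in>\<rho>. \<integral>\<^sup>+t. indicator E t * ?h t \<partial>m)"
    using near \<rho>(2) by (intro sum_mono) auto
  also have "\<dots> = (\<integral>\<^sup>+t. (\<Sum>E\<in>\<rho>. indicator E t * ?h t) \<partial>m)"
    by (rule nn_integral_sum[symmetric])
      (use \<rho>(2) sets hm in \<open>auto intro!: borel_measurable_times_ennreal borel_measurable_indicator\<close>)
  also have "\<dots> = (\<integral>\<^sup>+t. ?h t \<partial>m)"
  proof (rule nn_integral_cong)
    fix t
    obtain E0 where E0: "E0 \<in> \<rho>" "t \<in> E0" using partition_onD1[OF \<rho>(3)] by blast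
    have "t \<notin> E" if "E \<in> \<rho>" "E \<noteq> E0" for E
      using partition_onD2[OF \<rho>(3)] E0 that by (auto simp: disjoint_def)
    then have "(\<Sum>E\<in>\<rho>. indicator E t * ?h t) = (\<Sum>E\<in>\<rho>. if E = E0 then ?h t else 0)"
      using E0 by (intro sum.cong) (auto simp: indicator_def)
    then show "(\<Sum>E\<in>\<rho>. indicator E t * ?h t) = ?h t" using \<rho>(1) E0(1) by (simp add: sum.delta)
  qed
  also note close
  finally show "(\<Sum>E\<in>\<rho>. ?d E) \<le> e" using e by (simp add: ennreal_le_iff)
qed

lemma vector_measure_additive_variation_le:
  fixes \<nu> :: "'g::topological_space set \<Rightarrow> 'x::real_normed_vector"
  assumes sets: "sets m = sets borel" and \<nu>: "vector_measure m \<nu>" and bv: "bounded_variation m \<nu>"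
  shows "additive_variation_le \<nu> (enn2real (variation m \<nu>))"
proof -
  have space: "space m = UNIV" using sets_eq_imp_space_eq[OF sets] by simp
  have sums: "(\<lambda>n. \<nu> (A n)) sums \<nu> (\<Union>n. A n)"
    if "range A \<subseteq> sets borel" "disjoint_family A" for A :: "nat \<Rightarrow> 'g set"
    using \<nu> that sets unfolding vector_measure_def by auto
  have empty: "\<nu> {} = 0"
  proof -
    have "(\<lambda>n::nat. \<nu> {}) sums \<nu> {}"
      using sums[of "\<lambda>_. {}"] by (simp add: disjoint_family_on_def)
    then show ?thesis using summable_const_iff sums_summable by blast
  qed
  show ?thesis
    unfolding additive_variation_le_def
  proof (intro conjI ballI allI impI)
    fix A B :: "'g set" assume AB: "A \<in> sets borel" "B \<in> sets borel" "A \<inter> B = {}"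
    \<comment> \<open>Finite additivity is countable additivity for the sequence \<open>A, B, {}, {}, ...\<close>\<close>
    have "disjoint_family (binaryset A B)" using AB(3) by (auto simp: disjoint_family_on_def binaryset_def)
    then have "(\<lambda>n. \<nu> (binaryset A B n)) sums \<nu> (A \<union> B)"
      using sums[of "binaryset A B"] AB by (simp add: range_binaryset_eq UN_binaryset_eq)
    moreover have "(\<lambda>n. \<nu> (binaryset A B n)) sums (\<Sum>n\<in>{0, 1}. \<nu> (binaryset A B n))"
      by (rule sums_finite) (auto simp: binaryset_def empty)
    ultimately have "\<nu> (A \<union> B) = (\<Sum>n\<in>{0, 1::nat}. \<nu> (binaryset A B n))" by (rule sums_unique2)
    then show "\<nu> (A \<union> B) = \<nu> A + \<nu> B" by (simp add: binaryset_def)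
  next
    fix \<rho> :: "'g set set" assume \<rho>: "finite \<rho>" "\<rho> \<subseteq> sets borel" "partition_on UNIV \<rho>"
    have "ennreal (\<Sum>E\<in>\<rho>. norm (\<nu> E)) = (\<Sum>E\<in>\<rho>. ennreal (norm (\<nu> E)))" by (simp add: sum_ennreal)
    also have "\<dots> \<le> variation m \<nu>"
      unfolding variation_def using \<rho> sets space by (intro SUP_upper) auto
    also have "\<dots> = ennreal (enn2real (variation m \<nu>))"
      using bv by (simp add: bounded_variation_def)
    finally show "(\<Sum>E\<in>\<rho>. norm (\<nu> E)) \<le> enn2real (variation m \<nu>)" by (simp add: ennreal_le_iff)
  qed
qed

theorem proposition7p9:
  fixes m :: "'g::{topological_group_add,t2_space} measure"
    and smul :: "complex \<Rightarrow> 'x::banach \<Rightarrow> 'x"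
    and mnorm :: "'x mat \<Rightarrow> real"
    and \<nu> :: "'g set \<Rightarrow> 'x"
    and rep :: "('g \<Rightarrow> complex mat) set \<Rightarrow> 'g \<Rightarrow> complex mat"
  assumes compact: "compact (UNIV :: 'g set)"
    and haar: "normalized_haar_measure m"
    and X: "operator_space smul mnorm"
    and ac: "\<nu> \<in> M_ac m"
    and bv: "bounded_variation m \<nu>"
    and rnp: "radon_nikodym_property TYPE('x) m"
    and rep: "\<forall>c\<in>unitary_dual. rep c \<in> c"
  shows "(\<lambda>c. fourier_coeff smul \<nu> (rep c)) \<in>
           c0_direct_sum unitary_dual
             (\<lambda>c. carrier_mat (rep_dim (rep c)) (rep_dim (rep c))) mnorm"
proof -
  interpret operator_space smul mnorm by (rule X)
  note sets = haar_finite_measure(2)[OF haar]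
  define V where "V = enn2real (variation m \<nu>)"
  have \<nu>: "additive_variation_le \<nu> V"
    unfolding V_def using vector_measure_additive_variation_le[OF sets _ bv] ac by (simp add: M_ac_def)
  obtain f where f: "bochner_integrable m f"
    and dens: "\<And>A. A \<in> sets borel \<Longrightarrow> bochner_integral_is m (\<lambda>t. indicator A t *\<^sub>R f t) (\<nu> A)"
    using rnp ac bv sets unfolding radon_nikodym_property_def by blast
  obtain s where fm: "f \<in> borel_measurable m"
    and s: "\<And>n. Bochner_Integration.simple_bochner_integrable m (s n)"
    and s0: "(\<lambda>n. \<integral>\<^sup>+t. ennreal (norm (f t - s n t)) \<partial>m) \<longlonglongrightarrow> 0"
    using f by (auto simp: bochner_integrable_def bochner_integral_is_def)
  have "coeffs_vanish rep \<nu>"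
  proof (rule coeffs_vanish_limit[OF compact rep])
    fix e :: real assume e: "0 < e"
    have "\<forall>\<^sub>F n in sequentially. (\<integral>\<^sup>+t. ennreal (norm (f t - s n t)) \<partial>m) < ennreal e"
      using s0 e by (intro order_tendstoD) auto
    then obtain n where n: "(\<integral>\<^sup>+t. ennreal (norm (f t - s n t)) \<partial>m) < ennreal e"
      by (auto simp: eventually_sequentially)
    let ?\<mu> = "\<lambda>A. \<Sum>x\<in>range (s n). measure m (A \<inter> s n -` {x}) *\<^sub>R x"
    have "simple_function m (s n)"
      using s[of n] by (auto elim: Bochner_Integration.simple_bochner_integrable.cases)
    then have "finite (range (s n))" "\<And>x. s n -` {x} \<in> sets borel"
      using simple_functionD[of m "s n"] haar_finite_measure(3)[OF haar] sets by auto
    then have "additive_variation_le ?\<mu> (\<Sum>x\<in>range (s n). norm x) \<and> coeffs_vanish rep ?\<mu>"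
      by (intro coeffs_vanish_simple_density[OF compact haar rep]) auto
    moreover from this have "additive_variation_le (\<lambda>A. \<nu> A - ?\<mu> A) e"
      using n e by (intro additive_variation_le_density_diff[OF sets fm dens s \<nu>]) auto
    ultimately show "\<exists>\<mu> W. additive_variation_le \<mu> W \<and> coeffs_vanish rep \<mu> \<and>
        additive_variation_le (\<lambda>A. \<nu> A - \<mu> A) e" by blast
  qed
  moreover have "bdd_above ((\<lambda>c. mnorm (fourier_coeff smul \<nu> (rep c))) ` unitary_dual)"
  proof (rule bdd_aboveI2)
    fix c :: "('g \<Rightarrow> complex mat) set" assume "c \<in> unitary_dual"
    then have "irreducible_unitary_rep (rep c)" using unitary_dual_irreducible rep by blast
    then show "mnorm (fourier_coeff smul \<nu> (rep c)) \<le> V"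
      by (intro mnorm_fourier_coeff_le[OF compact \<nu>]) (auto simp: irreducible_unitary_rep_def)
  qed
  ultimately show ?thesis
    by (auto simp: c0_direct_sum_def coeffs_vanish_def fourier_coeff_def)
qed

end
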